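(* Let $k>0$. If $M$ is a rotationally symmetric Hadamard manifold with sectional curvature $K_M\le -k^2$, then $M$ satisfies the strict convexity condition (SC condition).
   Context: A Hadamard manifold is a complete simply connected Riemannian manifold of nonpositive sectional curvature. An $(n+1)$-dimensional Hadamard manifold $M$ is rotationally symmetric with center $o$ if it is (isometric to) $\mathbb R^{n+1}$, with $o$ the origin, endowed with the metric $dr^2+f(r)^2d\omega^2$, where $r$ is the distance to $o$, $d\omega^2$ is the standard metric of $\mathbb S^n$, and $f:[0,\infty)\to\mathbb R$ is smooth with $f(0)=0$, $f'(0)=1$ and $f>0$ on $(0,\infty)$. $\partial_\infty M$ is the asymptotic boundary of $M$ and $\overline M=M\cup\partial_\infty M$ its compactification in the cone topology. For $\Omega\subset M$, $\partial_\infty\Omega$ is the set of points of $\partial_\infty M$ in the closure of $\Omega$ in $\overline M$; $\operatorname{Int}(\partial_\infty\Omega)$ is its interior in $\partial_\infty M$. SC condition: for every $x\in\partial_\infty M$ and every relatively open $W\subset\partial_\infty M$ containing $x$, there is an open subset $\Omega\subset M$ of class $C^2$ (i.e. with $C^2$ boundary) such that $x\in\operatorname{Int}(\partial_\infty\Omega)\subset W$ and $M\setminus\Omega$ is (geodesically) convex. *)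

theory Defs
  imports "HOL-Analysis.Analysis"
begin

text \<open>
  By the Cartan--Hadamard theorem every Hadamard manifold is diffeomorphic to a Euclidean space.
  We work in such a global chart: a manifold is the type \<open>'a\<close> with its standard smooth structure,
  together with a metric tensor \<open>g\<close>, where \<open>g x u v\<close> is the product at the point \<open>x\<close> of the
  tangent vectors \<open>u\<close> and \<open>v\<close>.
\<close>

type_synonym 'a tensor = "'a \<Rightarrow> 'a \<Rightarrow> 'a \<Rightarrow> real"

subsection \<open>Smoothness\<close>

text \<open>Intended for open \<open>S\<close>.\<close>

primrec Ck_on :: "nat \<Rightarrow> 'a::euclidean_space set \<Rightarrow> ('a \<Rightarrow> real) \<Rightarrow> bool" where
  "Ck_on 0 S h \<longleftrightarrow> continuous_on S h"
| "Ck_on (Suc n) S h \<longleftrightarrow>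
     (\<forall>x\<in>S. h differentiable (at x)) \<and>
     (\<forall>v. Ck_on n S (\<lambda>x. frechet_derivative h (at x) v))"

definition smooth_on :: "'a::euclidean_space set \<Rightarrow> ('a \<Rightarrow> real) \<Rightarrow> bool" where
  "smooth_on S h \<longleftrightarrow> (\<forall>n. Ck_on n S h)"

text \<open>Smoothness on the closed half-line, with one-sided derivatives at 0.\<close>

definition smooth_on_halfline :: "(real \<Rightarrow> real) \<Rightarrow> bool" where
  "smooth_on_halfline f \<longleftrightarrow>
     (\<exists>D :: nat \<Rightarrow> real \<Rightarrow> real.
        (\<forall>t\<ge>0. D 0 t = f t) \<and>
        (\<forall>n. \<forall>t\<ge>0. (D n has_real_derivative D (Suc n) t) (at t within {0..})))"

subsection \<open>Riemannian metrics\<close>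

definition riemannian_metric :: "'a::euclidean_space tensor \<Rightarrow> bool" where
  "riemannian_metric g \<longleftrightarrow>
     (\<forall>x. bilinear (g x)) \<and>
     (\<forall>x u v. g x u v = g x v u) \<and>
     (\<forall>x u. u \<noteq> 0 \<longrightarrow> g x u u > 0) \<and>
     (\<forall>u v. smooth_on UNIV (\<lambda>x. g x u v))"

text \<open>
  The derivative of a piecewise \<open>C\<^sup>1\<close> path in the library sense may be unbounded near the exceptional
  points, so the length integral is required to exist; a non-integrable speed must not count as
  length 0.
\<close>

definition riem_dist :: "'a::euclidean_space tensor \<Rightarrow> 'a \<Rightarrow> 'a \<Rightarrow> real" where
  "riem_dist g x y =
     Inf {L. \<exists>c. valid_path c \<and> pathstart c = x \<and> pathfinish c = y \<and>
       ((\<lambda>t. sqrt (g (c t) (vector_derivative c (at t)) (vector_derivative c (at t))))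
          has_integral L) {0..1}}"

text \<open>
  \<open>christoffel g x u v\<close> is \<open>\<nabla>\<^sub>u v\<close> at \<open>x\<close> for the constant vector fields \<open>u\<close> and \<open>v\<close>,
  \<open>\<nabla>\<close> being the Levi-Civita connection; it is given by the Koszul formula.
\<close>

definition christoffel :: "'a::euclidean_space tensor \<Rightarrow> 'a \<Rightarrow> 'a \<Rightarrow> 'a \<Rightarrow> 'a" where
  "christoffel g x u v =
     (THE w. \<forall>z. g x w z =
        (frechet_derivative (\<lambda>y. g y v z) (at x) u
         + frechet_derivative (\<lambda>y. g y u z) (at x) v
         - frechet_derivative (\<lambda>y. g y u v) (at x) z) / 2)"

text \<open>
  \<open>R(u,v)w = \<nabla>\<^sub>u \<nabla>\<^sub>v w - \<nabla>\<^sub>v \<nabla>\<^sub>u w\<close> for constant vector fields, whose Lie brackets vanish.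
\<close>

definition riem_curvature :: "'a::euclidean_space tensor \<Rightarrow> 'a \<Rightarrow> 'a \<Rightarrow> 'a \<Rightarrow> 'a \<Rightarrow> 'a" where
  "riem_curvature g x u v w =
     frechet_derivative (\<lambda>y. christoffel g y v w) (at x) u
     - frechet_derivative (\<lambda>y. christoffel g y u w) (at x) v
     + christoffel g x u (christoffel g x v w)
     - christoffel g x v (christoffel g x u w)"

definition sectional_curvature :: "'a::euclidean_space tensor \<Rightarrow> 'a \<Rightarrow> 'a \<Rightarrow> 'a \<Rightarrow> real" where
  "sectional_curvature g x u v =
     g x (riem_curvature g x u v v) u / (g x u u * g x v v - (g x u v)\<^sup>2)"

definition sectional_curvature_le :: "'a::euclidean_space tensor \<Rightarrow> real \<Rightarrow> bool" where
  "sectional_curvature_le g K \<longleftrightarrow>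
     (\<forall>x u v. u \<noteq> v \<and> independent {u, v} \<longrightarrow> sectional_curvature g x u v \<le> K)"

definition hadamard :: "'a::euclidean_space tensor \<Rightarrow> bool" where
  "hadamard g \<longleftrightarrow>
     riemannian_metric g \<and>
     Metric_space.mcomplete UNIV (riem_dist g) \<and>
     simply_connected (UNIV :: 'a set) \<and>
     sectional_curvature_le g 0"

subsection \<open>Rotationally symmetric metrics\<close>

text \<open>
  The metric \<open>dr\<^sup>2 + f(r)\<^sup>2 d\<omega>\<^sup>2\<close>: with \<open>e = sgn x\<close> the radial unit vector at \<open>x \<noteq> 0\<close>, one has
  \<open>dr(u) = u \<bullet> e\<close> and \<open>d\<omega>\<^sup>2(u,v) = (u \<bullet> v - dr(u) dr(v)) / r\<^sup>2\<close>. At the origin this is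
  extended by its limit, the Euclidean product, since \<open>f(0) = 0\<close> and \<open>f'(0) = 1\<close>.
\<close>

definition warped_metric :: "(real \<Rightarrow> real) \<Rightarrow> 'a::euclidean_space tensor" where
  "warped_metric f x u v =
     (if x = 0 then u \<bullet> v
      else (u \<bullet> sgn x) * (v \<bullet> sgn x)
           + (f (norm x))\<^sup>2 * ((u \<bullet> v - (u \<bullet> sgn x) * (v \<bullet> sgn x)) / (norm x)\<^sup>2))"

text \<open>The center is the origin.\<close>

definition rotationally_symmetric :: "'a::euclidean_space tensor \<Rightarrow> bool" where
  "rotationally_symmetric g \<longleftrightarrow>
     (\<exists>f. smooth_on_halfline f \<and> f 0 = 0 \<and>
          (f has_real_derivative 1) (at 0 within {0..}) \<and>
          (\<forall>t>0. f t > 0) \<and>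
          g = warped_metric f)"

subsection \<open>Geodesics and convexity\<close>

text \<open>\<open>c\<close> is a geodesic on the interval \<open>I\<close> with velocity \<open>c'\<close>.\<close>

definition geodesic_on ::
  "'a::euclidean_space tensor \<Rightarrow> real set \<Rightarrow> (real \<Rightarrow> 'a) \<Rightarrow> (real \<Rightarrow> 'a) \<Rightarrow> bool" where
  "geodesic_on g I c c' \<longleftrightarrow>
     (\<forall>t\<in>I. (c has_vector_derivative c' t) (at t within I) \<and>
             (c' has_vector_derivative - christoffel g (c t) (c' t) (c' t)) (at t within I))"

text \<open>
  In a Hadamard manifold any two points are joined by exactly one geodesic, up to
  parametrization, so quantifying over all geodesics with end points in \<open>C\<close> is the usual notion.
\<close>

definition geodesically_convex :: "'a::euclidean_space tensor \<Rightarrow> 'a set \<Rightarrow> bool" where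
  "geodesically_convex g C \<longleftrightarrow>
     (\<forall>c c'. geodesic_on g {0..1} c c' \<and> c 0 \<in> C \<and> c 1 \<in> C \<longrightarrow> c ` {0..1} \<subseteq> C)"

definition unit_ray :: "'a::euclidean_space tensor \<Rightarrow> (real \<Rightarrow> 'a) \<Rightarrow> (real \<Rightarrow> 'a) \<Rightarrow> bool" where
  "unit_ray g c c' \<longleftrightarrow>
     geodesic_on g {0..} c c' \<and> (\<forall>t\<ge>0. g (c t) (c' t) (c' t) = 1)"

subsection \<open>The compactification\<close>

definition asymptotic_rays ::
  "'a::euclidean_space tensor \<Rightarrow> ((real \<Rightarrow> 'a) \<times> (real \<Rightarrow> 'a)) set" where
  "asymptotic_rays g =
     {(c, d). (\<exists>c'. unit_ray g c c') \<and> (\<exists>d'. unit_ray g d d') \<and>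
              (\<exists>B. \<forall>t\<ge>0. riem_dist g (c t) (d t) \<le> B)}"

text \<open>
  The points of the compactification are \<open>Inl x\<close> for the points \<open>x\<close> of the manifold and
  \<open>Inr \<xi>\<close> for the classes \<open>\<xi>\<close> of asymptotic unit speed geodesic rays.
\<close>

type_synonym 'a compactified = "'a + (real \<Rightarrow> 'a) set"

definition asymptotic_boundary :: "'a::euclidean_space tensor \<Rightarrow> 'a compactified set" where
  "asymptotic_boundary g = Inr ` ({c. \<exists>c'. unit_ray g c c'} // asymptotic_rays g)"

definition tangent_angle :: "'a::euclidean_space tensor \<Rightarrow> 'a \<Rightarrow> 'a \<Rightarrow> 'a \<Rightarrow> real" where
  "tangent_angle g p u v = arccos (g p u v / (sqrt (g p u u) * sqrt (g p v v)))"

text \<open>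
  The cone with vertex \<open>p\<close>, axis \<open>v\<close> and opening angle \<open>\<epsilon>\<close>, minus the closed ball of radius \<open>R\<close>
  about \<open>p\<close>. Its points are described through the geodesic rays issuing from \<open>p\<close>.
\<close>

definition truncated_cone ::
  "'a::euclidean_space tensor \<Rightarrow> 'a \<Rightarrow> 'a \<Rightarrow> real \<Rightarrow> real \<Rightarrow> 'a compactified set" where
  "truncated_cone g p v \<epsilon> R =
     {Inl (c s) | c c' s. unit_ray g c c' \<and> c 0 = p \<and> tangent_angle g p v (c' 0) < \<epsilon> \<and>
                          s \<ge> 0 \<and> riem_dist g p (c s) > R} \<union>
     {\<xi> \<in> asymptotic_boundary g.
        \<exists>c c' C. \<xi> = Inr C \<and> c \<in> C \<and> unit_ray g c c' \<and> c 0 = p \<and>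
                  tangent_angle g p v (c' 0) < \<epsilon>}"

text \<open>
  The cone topology, generated by the open sets of the manifold and the truncated cones with a
  fixed vertex \<open>p\<close>; for Hadamard manifolds it does not depend on \<open>p\<close>.
\<close>

definition cone_topology :: "'a::euclidean_space tensor \<Rightarrow> 'a \<Rightarrow> 'a compactified topology" where
  "cone_topology g p =
     topology_generated_by
       ({Inl ` U | U. open U} \<union>
        {truncated_cone g p v \<epsilon> R | v \<epsilon> R. g p v v = 1 \<and> \<epsilon> > 0 \<and> R > 0})"

definition boundary_at_infinity ::
  "'a::euclidean_space tensor \<Rightarrow> 'a \<Rightarrow> 'a set \<Rightarrow> 'a compactified set" where
  "boundary_at_infinity g p \<Omega> =
     (cone_topology g p closure_of (Inl ` \<Omega>)) \<inter> asymptotic_boundary g"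

subsection \<open>The strict convexity condition\<close>

definition C2_domain :: "'a::euclidean_space set \<Rightarrow> bool" where
  "C2_domain \<Omega> \<longleftrightarrow>
     open \<Omega> \<and>
     (\<forall>x\<in>frontier \<Omega>. \<exists>U \<rho>. open U \<and> x \<in> U \<and> Ck_on 2 U \<rho> \<and>
        (\<forall>y\<in>U. \<exists>v. frechet_derivative \<rho> (at y) v \<noteq> 0) \<and>
        \<Omega> \<inter> U = {y\<in>U. \<rho> y < 0})"

text \<open>The base point \<open>p\<close> only serves to describe the cone topology.\<close>

definition SC_condition :: "'a::euclidean_space tensor \<Rightarrow> 'a \<Rightarrow> bool" where
  "SC_condition g p \<longleftrightarrow>
     (let T = subtopology (cone_topology g p) (asymptotic_boundary g) in
      \<forall>x\<in>asymptotic_boundary g. \<forall>W. openin T W \<and> x \<in> W \<longrightarrow>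
        (\<exists>\<Omega>. C2_domain \<Omega> \<and>
             x \<in> T interior_of (boundary_at_infinity g p \<Omega>) \<and>
             T interior_of (boundary_at_infinity g p \<Omega>) \<subseteq> W \<and>
             geodesically_convex g (- \<Omega>)))"

end

theory Submission
  imports Defs
begin

text \<open>
  The curvature of the planes containing the radial direction is \<open>- f'' / f\<close>, so \<open>f'' \<ge> k\<^sup>2 f\<close>, which gives
  \<open>f' \<ge> 1\<close>, \<open>f r \<ge> r\<close>, \<open>r f' \<ge> f\<close> and \<open>f f' \<ge> k r\<^sup>2\<close>. For a unit vector \<open>e\<close> and \<open>0 \<le> a < 1\<close> take
  \<open>\<Omega> = {x. x \<bullet> e > a \<bar>x\<bar> + 1/k}\<close>, one side of a hyperboloid in the Euclidean chart; the directions at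
  infinity of \<open>\<Omega>\<close> are those at angle at most \<open>arccos a\<close> from \<open>e\<close>. On \<open>\<Omega>\<close> the function
  \<open>h x = f r (cos \<theta> - a - 1/(k r))\<close>, with \<open>r = \<bar>x\<bar>\<close> and \<open>\<theta>\<close> the angle between \<open>x\<close> and \<open>e\<close>, is positive and
  convex along geodesics, so \<open>h\<close> cannot have an interior maximum on a geodesic segment leaving
  the complement of \<open>\<Omega>\<close> and coming back; hence that complement is convex.
  In hyperbolic space \<open>f cos \<theta>\<close> is a Minkowski-linear function, which suggests this shape of \<open>h\<close>.

  A geodesic ray from the origin is a straight line, because its radial speed is nondecreasing, tends
  to 1 at the origin and is at most 1. As \<open>f r \<ge> r\<close>, the Riemannian distance dominates the Euclidean
  one, so asymptotic rays from the origin coincide, and points at infinity can be told apart by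
  their directions.
\<close>

section \<open>Connection and curvature of a warped metric\<close>

lemma norm_has_derivative:
  fixes x :: "'a::real_inner"
  assumes "x \<noteq> 0"
  shows "(norm has_derivative (\<lambda>h. (h \<bullet> x) / norm x)) (at x)"
  using has_derivative_norm[OF assms] by (simp add: sgn_div_norm divide_inverse mult.commute)

text \<open>\<open>f1\<close> and \<open>f2\<close> are the first two derivatives of the warping
  function, one-sided because \<open>f\<close> carries information on the half-line only. The
  curvature bound enters later, in \<open>curved_warping\<close>, since it has to be read off from
  the connection computed here.\<close>

locale warping =
  fixes f f1 f2 :: "real \<Rightarrow> real"
  assumes f_0: "f 0 = 0"
    and f1_0: "f1 0 = 1"
    and f_deriv_within: "0 \<le> t \<Longrightarrow> (f has_real_derivative f1 t) (at t within {0..})"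
    and f1_deriv_within: "0 \<le> t \<Longrightarrow> (f1 has_real_derivative f2 t) (at t within {0..})"
    and f_pos: "0 < t \<Longrightarrow> 0 < f t"
begin

lemma f_deriv: "0 < t \<Longrightarrow> (f has_real_derivative f1 t) (at t)"
  using f_deriv_within[of t] at_within_interior[of t "{0..}"] by simp

lemma f1_deriv: "0 < t \<Longrightarrow> (f1 has_real_derivative f2 t) (at t)"
  using f1_deriv_within[of t] at_within_interior[of t "{0..}"] by simp

abbreviation g :: "'a::euclidean_space tensor" where
  "g \<equiv> warped_metric f"

text \<open>Serves differentiation: only radial functions and linear forms in \<open>x\<close>
  occur, so the product rule applies directly.\<close>

lemma metric_eq:
  fixes x :: "'a::euclidean_space"
  assumes "x \<noteq> 0"
  shows "g x u v = (f (norm x) / norm x)\<^sup>2 * (u \<bullet> v)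
    + (1 - (f (norm x) / norm x)\<^sup>2) / (norm x)\<^sup>2 * (u \<bullet> x) * (v \<bullet> x)"
  using assms
  by (simp add: warped_metric_def sgn_div_norm field_simps power2_eq_square)

lemma metric_0: "g 0 u v = u \<bullet> v"
  by (simp add: warped_metric_def)

text \<open>Pairing with \<open>x\<close> gives exactly \<open>d \<bullet> x\<close>, which
  therefore vanishes; pairing with \<open>d\<close> then leaves a positive multiple of
  \<open>d \<bullet> d\<close>. This yields uniqueness in the description of
  \<open>christoffel\<close>.\<close>

lemma metric_nondegenerate:
  fixes x d :: "'a::euclidean_space"
  assumes x: "x \<noteq> 0" and "\<And>z. g x d z = 0"
  shows "d = 0"
proof -
  define A where "A = (f (norm x) / norm x)\<^sup>2"
  have A: "A > 0" using x f_pos[of "norm x"] by (simp add: A_def)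
  have eq: "A * (d \<bullet> z) + (1 - A) / (norm x)\<^sup>2 * (d \<bullet> x) * (z \<bullet> x) = 0" for z
    using assms(2)[of z] by (simp add: metric_eq[OF x] A_def)
  from eq[of x] have "d \<bullet> x = 0"
    using x by (simp add: field_simps flip: power2_norm_eq_inner)
  with eq[of d] A show "d = 0" by simp
qed

section \<open>Derivative of the metric and Christoffel symbols\<close>

lemma has_derivative_radial:
  fixes x :: "'a::euclidean_space"
  assumes "x \<noteq> 0" "(\<phi> has_real_derivative D) (at (norm x))"
  shows "((\<lambda>y. \<phi> (norm y)) has_derivative (\<lambda>h. D * ((h \<bullet> x) / norm x))) (at x)"
proof -
  from has_derivative_compose[OF norm_has_derivative[OF assms(1)] has_field_derivative_imp_has_derivative[OF assms(2)]]
  show ?thesis .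
qed

lemma metric_has_derivative:
  fixes x v z :: "'a::euclidean_space"
  assumes x: "x \<noteq> 0"
  defines "r \<equiv> norm x"
  defines "A \<equiv> (f r / r)\<^sup>2"
  defines "A' \<equiv> 2 * f r * f1 r / r\<^sup>2 - 2 * (f r)\<^sup>2 / r ^ 3"
  shows "((\<lambda>y. g y v z) has_derivative
    (\<lambda>u. A' * ((u \<bullet> x) / r) * (v \<bullet> z) + (- A' / r\<^sup>2 - 2 * (1 - A) / r ^ 3) * ((u \<bullet> x) / r) * (v \<bullet> x) * (z \<bullet> x)
       + (1 - A) / r\<^sup>2 * ((v \<bullet> u) * (z \<bullet> x) + (v \<bullet> x) * (z \<bullet> u)))) (at x)"
proof -
  have r: "r > 0" using x by (simp add: r_def)
  have d1: "((\<lambda>s. (f s / s)\<^sup>2) has_real_derivative A') (at r)"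
    using r unfolding A'_def
    by (auto intro!: derivative_eq_intros f_deriv simp: field_simps power2_eq_square power3_eq_cube)
  have "((\<lambda>s. (1 - \<alpha> s) / s\<^sup>2) has_real_derivative (- A' / r\<^sup>2 - 2 * (1 - \<alpha> r) / r ^ 3)) (at r)"
    if "(\<alpha> has_real_derivative A') (at r)" for \<alpha>
    using r by (auto intro!: derivative_eq_intros that simp: field_simps eval_nat_numeral)
  from this[OF d1]
  have d2: "((\<lambda>s. (1 - (f s / s)\<^sup>2) / s\<^sup>2) has_real_derivative (- A' / r\<^sup>2 - 2 * (1 - A) / r ^ 3)) (at r)"
    by (simp add: A_def)
  have d3: "((\<lambda>y. (f (norm y) / norm y)\<^sup>2) has_derivative (\<lambda>h. A' * ((h \<bullet> x) / r))) (at x)"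
    using has_derivative_radial[OF x d1[unfolded r_def]] by (simp add: r_def)
  have d4: "((\<lambda>y. (1 - (f (norm y) / norm y)\<^sup>2) / (norm y)\<^sup>2) has_derivative
     (\<lambda>h. (- A' / r\<^sup>2 - 2 * (1 - A) / r ^ 3) * ((h \<bullet> x) / r))) (at x)"
    using has_derivative_radial[OF x d2[unfolded r_def]] by (simp add: r_def)
  define \<alpha> \<beta> :: "'a \<Rightarrow> real"
    where "\<alpha> y = (f (norm y) / norm y)\<^sup>2" and "\<beta> y = (1 - (f (norm y) / norm y)\<^sup>2) / (norm y)\<^sup>2" for y
  note d = d3[folded \<alpha>_def] d4[folded \<beta>_def]
  have "((\<lambda>y. \<alpha> y * (v \<bullet> z) + \<beta> y * (v \<bullet> y) * (z \<bullet> y)) has_derivative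
    (\<lambda>u. A' * ((u \<bullet> x) / r) * (v \<bullet> z) + (- A' / r\<^sup>2 - 2 * (1 - A) / r ^ 3) * ((u \<bullet> x) / r) * (v \<bullet> x) * (z \<bullet> x)
       + (1 - A) / r\<^sup>2 * ((v \<bullet> u) * (z \<bullet> x) + (v \<bullet> x) * (z \<bullet> u)))) (at x)"
    by (rule derivative_eq_intros d refl)+ (rule ext, simp add: \<alpha>_def \<beta>_def A_def r_def algebra_simps add_divide_distrib diff_divide_distrib)
  then show ?thesis
    by (rule has_derivative_transform_within_open[where s="-{0}"])
       (use x in \<open>auto simp: metric_eq \<alpha>_def \<beta>_def\<close>)
qed

text \<open>
  The coefficients of the Christoffel symbols at distance \<open>r\<close> from the origin; \<open>S\<close> makes
  \<open>Gam x x x\<close> vanish, radial lines being geodesics.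
\<close>

definition P :: "real \<Rightarrow> real" where "P r = f1 r / (f r * r) - 1 / r\<^sup>2"
definition Q :: "real \<Rightarrow> real" where "Q r = 1 / r\<^sup>2 - f r * f1 r / r ^ 3"

definition S :: "real \<Rightarrow> real" where "S r = (2 * P r + Q r) / r\<^sup>2"

definition Gam :: "'a::euclidean_space \<Rightarrow> 'a \<Rightarrow> 'a \<Rightarrow> 'a" where
  "Gam x u v = P (norm x) *\<^sub>R ((x \<bullet> u) *\<^sub>R v + (x \<bullet> v) *\<^sub>R u)
     + (Q (norm x) * (u \<bullet> v) - S (norm x) * (x \<bullet> u) * (x \<bullet> v)) *\<^sub>R x"

lemma christoffel_eq:
  fixes x u v :: "'a::euclidean_space"
  assumes x: "x \<noteq> 0"
  shows "christoffel g x u v = Gam x u v"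
proof -
  define r where "r = norm x"
  have r: "r > 0" "f r > 0" using x f_pos by (auto simp: r_def)
  have xx: "x \<bullet> x = r\<^sup>2" by (simp add: r_def power2_norm_eq_inner)
  have D: "frechet_derivative (\<lambda>y. g y v z) (at x) u =
     (2 * f r * f1 r / r\<^sup>2 - 2 * (f r)\<^sup>2 / r ^ 3) * ((u \<bullet> x) / r) * (v \<bullet> z)
     + (- (2 * f r * f1 r / r\<^sup>2 - 2 * (f r)\<^sup>2 / r ^ 3) / r\<^sup>2 - 2 * (1 - (f r / r)\<^sup>2) / r ^ 3) * ((u \<bullet> x) / r) * (v \<bullet> x) * (z \<bullet> x)
       + (1 - (f r / r)\<^sup>2) / r\<^sup>2 * ((v \<bullet> u) * (z \<bullet> x) + (v \<bullet> x) * (z \<bullet> u))" for u v z :: 'a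
    using frechet_derivative_at[OF metric_has_derivative[OF x, of v z], symmetric]
    by (simp add: r_def)
  have ex: "\<forall>z. g x (Gam x u v) z =
      (frechet_derivative (\<lambda>y. g y v z) (at x) u
       + frechet_derivative (\<lambda>y. g y u z) (at x) v
       - frechet_derivative (\<lambda>y. g y u v) (at x) z) / 2"
  proof
    fix z
    have "u \<bullet> x = x \<bullet> u" "v \<bullet> x = x \<bullet> v" "z \<bullet> x = x \<bullet> z" "v \<bullet> u = u \<bullet> v" "z \<bullet> u = u \<bullet> z" "z \<bullet> v = v \<bullet> z"
      by (simp_all add: inner_commute)
    note c = this
    \<comment> \<open>Naming the six inner products and the two values of the warping function turns
      the Koszul formula into a rational identity in real variables.\<close>
    obtain xu xv xz uv uz vz F F1 where
      n: "x \<bullet> u = xu" "x \<bullet> v = xv" "x \<bullet> z = xz" "u \<bullet> v = uv" "u \<bullet> z = uz" "v \<bullet> z = vz" "f r = F" "f1 r = F1"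
      by blast
    have F: "F > 0" using r n by simp
    show "g x (Gam x u v) z =
      (frechet_derivative (\<lambda>y. g y v z) (at x) u
       + frechet_derivative (\<lambda>y. g y u z) (at x) v
       - frechet_derivative (\<lambda>y. g y u v) (at x) z) / 2"
      unfolding D metric_eq[OF x] r_def[symmetric] Gam_def S_def P_def Q_def c inner_add_left inner_add_right inner_scaleR_left
        inner_scaleR_right n xx
      using r(1) F by (simp add: field_simps power2_eq_square power3_eq_cube)
  qed
  have uniq: "w = Gam x u v" if w: "\<forall>z. g x w z =
      (frechet_derivative (\<lambda>y. g y v z) (at x) u
       + frechet_derivative (\<lambda>y. g y u z) (at x) v
       - frechet_derivative (\<lambda>y. g y u v) (at x) z) / 2" for w
  proof -
  have "g x (w - Gam x u v) z = g x w z - g x (Gam x u v) z" for z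
    by (simp add: metric_eq[OF x] inner_diff_left algebra_simps diff_divide_distrib add_divide_distrib)
  then have "g x (w - Gam x u v) z = 0" for z
    using w ex by simp
  from metric_nondegenerate[OF x this] show "w = Gam x u v" by simp
  qed
  show ?thesis
    unfolding christoffel_def by (rule the_equality, rule ex, rule uniq)
qed

section \<open>Curvature of the planes containing the radial direction\<close>

lemma Gam_has_derivative:
  fixes x u v :: "'a::euclidean_space"
  assumes x: "x \<noteq> 0"
    and D: "(P has_real_derivative P') (at (norm x))" "(Q has_real_derivative Q') (at (norm x))"
      "(S has_real_derivative S') (at (norm x))"
  shows "((\<lambda>y. Gam y u v) has_derivative
     (\<lambda>h. (P' * ((h \<bullet> x) / norm x)) *\<^sub>R ((x \<bullet> u) *\<^sub>R v + (x \<bullet> v) *\<^sub>R u)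
        + P (norm x) *\<^sub>R ((h \<bullet> u) *\<^sub>R v + (h \<bullet> v) *\<^sub>R u)
        + (Q' * ((h \<bullet> x) / norm x) * (u \<bullet> v) - S' * ((h \<bullet> x) / norm x) * (x \<bullet> u) * (x \<bullet> v)
           - S (norm x) * ((h \<bullet> u) * (x \<bullet> v) + (x \<bullet> u) * (h \<bullet> v))) *\<^sub>R x
        + (Q (norm x) * (u \<bullet> v) - S (norm x) * (x \<bullet> u) * (x \<bullet> v)) *\<^sub>R h)) (at x)"
  unfolding Gam_def
  by (rule derivative_eq_intros D[THEN has_derivative_radial[OF x]] refl)+
     (rule ext, simp add: algebra_simps)

lemma radial_curvature:
  fixes e v :: "'a::euclidean_space"
  assumes r: "r > 0" and e: "norm e = 1" "norm v = 1" "e \<bullet> v = 0"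
  shows "sectional_curvature g (r *\<^sub>R e) e v = - f2 r / f r"
proof -
  define x where "x = r *\<^sub>R e"
  have x: "x \<noteq> 0" "norm x = r" using r e by (auto simp: x_def)
  have F: "f r > 0" using r f_pos by simp
  have ee: "e \<bullet> e = 1" "v \<bullet> v = 1" "v \<bullet> e = 0"
    using e by (simp_all add: norm_eq_1 inner_commute)
  \<comment> \<open>For \<open>P\<close> and \<open>S\<close> only differentiability matters: in
    \<open>1\<close> and \<open>2\<close> their derivatives are multiplied by
    \<open>x \<bullet> v = 0\<close>. The derivative of \<open>Q\<close> does enter and is
    computed.\<close>
  have DP: "\<exists>D. (P has_real_derivative D) (at r)"
    unfolding P_def using r F by (auto intro!: exI derivative_eq_intros f_deriv f1_deriv)
  then obtain P' where DP: "(P has_real_derivative P') (at r)" by blast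
  define Q' where "Q' = - 2 / r ^ 3 - (f1 r * f1 r + f r * f2 r) / r ^ 3 + 3 * f r * f1 r / r ^ 4"
  have DQ: "(Q has_real_derivative Q') (at r)"
    unfolding Q_def using r
    by (auto intro!: derivative_eq_intros f_deriv f1_deriv)
       (simp add: Q'_def field_simps eval_nat_numeral)
  have "\<exists>D. (S has_real_derivative D) (at r)"
    unfolding S_def using r by (auto intro!: exI derivative_eq_intros DP DQ)
  then obtain S' where DS: "(S has_real_derivative S') (at r)" by blast
  note D = Gam_has_derivative[OF x(1), unfolded x(2), OF DP DQ DS]
  have chr: "((\<lambda>y. christoffel g y a b) has_derivative F) (at x)"
    if "((\<lambda>y. Gam y a b) has_derivative F) (at x)" for a b F
    using that by (rule has_derivative_transform_within_open[where s="-{0}"])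
      (use x in \<open>auto simp: christoffel_eq\<close>)
  have fd: "frechet_derivative (\<lambda>y. christoffel g y a b) (at x) = F"
    if "((\<lambda>y. Gam y a b) has_derivative F) (at x)" for a b F
    using frechet_derivative_at[OF chr[OF that]] by simp
  have xe: "x \<bullet> e = r" "x \<bullet> v = 0" "e \<bullet> x = r" "v \<bullet> x = 0"
    using ee e by (simp_all add: x_def inner_commute)
  have 1: "frechet_derivative (\<lambda>y. christoffel g y v v) (at x) e = (Q' * r + Q r) *\<^sub>R e"
    unfolding fd[OF D] using r by (simp add: xe ee e) (simp add: x_def algebra_simps)
  have 2: "frechet_derivative (\<lambda>y. christoffel g y e v) (at x) v = (P r - S r * r\<^sup>2) *\<^sub>R e"
    unfolding fd[OF D] using r by (simp add: xe ee e) (simp add: x_def algebra_simps power2_eq_square)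
  have 3: "christoffel g x v v = (Q r * r) *\<^sub>R e"
    unfolding christoffel_eq[OF x(1)] Gam_def x by (simp add: xe ee e) (simp add: x_def algebra_simps)
  have 4: "christoffel g x e v = (P r * r) *\<^sub>R v"
    unfolding christoffel_eq[OF x(1)] Gam_def x by (simp add: xe ee e)
  have 5: "christoffel g x e (a *\<^sub>R e) = 0" for a
  proof -
    have "christoffel g x e (a *\<^sub>R e) = (a * (P r * r + P r * r + Q r * r - S r * r ^ 3)) *\<^sub>R e"
      unfolding christoffel_eq[OF x(1)] Gam_def x
      by (simp add: xe ee e) (simp add: x_def algebra_simps power3_eq_cube, simp flip: scaleR_add_left)
    also have "P r * r + P r * r + Q r * r - S r * r ^ 3 = 0"
      using r by (simp add: S_def field_simps power2_eq_square power3_eq_cube)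
    finally show ?thesis by simp
  qed
  have 6: "christoffel g x v (a *\<^sub>R v) = (a * Q r * r) *\<^sub>R e" for a
    unfolding christoffel_eq[OF x(1)] Gam_def x by (simp add: xe ee e) (simp add: x_def algebra_simps)
  have R: "riem_curvature g x e v v = (Q' * r + Q r - (P r - S r * r\<^sup>2) - P r * r * Q r * r) *\<^sub>R e"
    unfolding riem_curvature_def 1 2 3 4 5 6 by (simp add: algebra_simps)
  have M: "g x (a *\<^sub>R e) e = a" "g x v v = (f r / r)\<^sup>2" "g x e v = 0" for a
    unfolding metric_eq[OF x(1)] x by (simp_all add: xe ee e) (use r in \<open>simp add: field_simps power2_eq_square\<close>)
  have S: "S r * r\<^sup>2 = 2 * P r + Q r"
    using r by (simp add: S_def)
  \<comment> \<open>All terms in \<open>f1\<close> cancel, and only the second derivative of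
    \<open>f\<close> survives.\<close>
  have K: "Q' * r + Q r - (P r - S r * r\<^sup>2) - P r * r * Q r * r = - f2 r * f r / r\<^sup>2"
    using r F unfolding S Q'_def P_def Q_def
    by (simp add: field_simps eval_nat_numeral)
  show ?thesis
    unfolding sectional_curvature_def x_def[symmetric] R K M M(1)[of 1, simplified]
    using r F by (simp add: field_simps power2_eq_square)
qed

end

section \<open>A function convex along geodesics\<close>

text \<open>At an interior maximum \<open>\<phi>'\<close> vanishes; a positive derivative of
  \<open>\<phi>'\<close> makes it positive just to the right, and by the mean value theorem
  \<open>\<phi>\<close> rises above its maximum.\<close>

lemma not_local_max_if_second_deriv_pos:
  fixes \<phi> \<phi>' :: "real \<Rightarrow> real"
  assumes d: "d > 0"
    and deriv: "\<And>t. \<bar>t - s\<bar> < d \<Longrightarrow> (\<phi> has_real_derivative \<phi>' t) (at t)"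
    and deriv2: "(\<phi>' has_real_derivative D) (at s)" and D: "D > 0"
    and max: "\<And>t. \<bar>t - s\<bar> < d \<Longrightarrow> \<phi> t \<le> \<phi> s"
  shows False
proof -
  have "\<phi>' s = 0"
    using DERIV_local_max[OF deriv[of s] d] max d by (auto simp: abs_minus_commute)
  obtain d' where d': "d' > 0" "\<And>h. 0 < h \<Longrightarrow> h < d' \<Longrightarrow> \<phi>' s < \<phi>' (s + h)"
    using DERIV_pos_inc_right[OF deriv2 D] by blast
  define h where "h = min d d' / 2"
  have h: "0 < h" "h < d" "h < d'" using d d' by (auto simp: h_def)
  obtain z where z: "s < z" "z < s + h" "\<phi> (s + h) - \<phi> s = (s + h - s) * \<phi>' z"
    using MVT2[of s "s + h" \<phi> \<phi>'] h deriv by (auto simp: abs_if)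
  have "\<phi>' z > 0"
    using d'(2)[of "z - s"] z h \<open>\<phi>' s = 0\<close> by auto
  with z h have "\<phi> (s + h) > \<phi> s" by (simp add: algebra_simps)
  moreover have "\<phi> (s + h) \<le> \<phi> s" using max[of "s + h"] h by auto
  ultimately show False by simp
qed

text \<open>The sign is asked for only beyond \<open>s\<close>, so that \<open>s = 0\<close> is
  allowed although the curvature bound controls \<open>f2\<close> at positive arguments
  only.\<close>

lemma halfline_mono:
  fixes \<phi> \<phi>' :: "real \<Rightarrow> real"
  assumes "0 \<le> s" "s \<le> t"
    and "\<And>x. s \<le> x \<Longrightarrow> (\<phi> has_real_derivative \<phi>' x) (at x within {0..})"
    and "\<And>x. s < x \<Longrightarrow> 0 \<le> \<phi>' x"
  shows "\<phi> s \<le> \<phi> t"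
proof (rule DERIV_nonneg_imp_increasing_open[OF assms(2)])
  show "\<exists>y. (\<phi> has_real_derivative y) (at x) \<and> 0 \<le> y" if "s < x" "x < t" for x
    using assms(1) assms(3)[of x] assms(4)[of x] that at_within_interior[of x "{0..}"] by auto
  show "continuous_on {s..t} \<phi>"
  proof (rule DERIV_continuous_on)
    show "(\<phi> has_real_derivative \<phi>' x) (at x within {s..t})" if "x \<in> {s..t}" for x
      by (rule DERIV_subset[OF assms(3)]) (use that assms(1) in auto)
  qed
qed

section \<open>Distance to the origin and linear functions along a geodesic\<close>

context warping
begin

text \<open>
  For a curve through \<open>x\<close> with velocity \<open>u\<close>, \<open>rho\<close> is the derivative of the distance to the origin
  and \<open>tau\<close> is the square of the Euclidean length of the tangential part of \<open>u\<close>.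
\<close>

definition rho :: "'a::euclidean_space \<Rightarrow> 'a \<Rightarrow> real" where
  "rho x u = (x \<bullet> u) / norm x"

definition tau :: "'a::euclidean_space \<Rightarrow> 'a \<Rightarrow> real" where
  "tau x u = u \<bullet> u - (rho x u)\<^sup>2"

lemma tau_nonneg: "tau x u \<ge> 0"
proof (cases "x = 0")
  case False
  have "(x \<bullet> u)\<^sup>2 \<le> (x \<bullet> x) * (u \<bullet> u)" by (rule Cauchy_Schwarz_ineq)
  with False show ?thesis
    by (simp add: tau_def rho_def power_divide power2_norm_eq_inner field_simps)
qed (simp add: tau_def rho_def)

lemma metric_rho_tau:
  fixes x :: "'a::euclidean_space"
  assumes "x \<noteq> 0"
  shows "g x u u = (rho x u)\<^sup>2 + (f (norm x) / norm x)\<^sup>2 * tau x u"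
  using assms by (simp add: metric_eq rho_def tau_def inner_commute field_simps power2_eq_square)

text \<open>The left-hand side is half the second derivative of the squared Euclidean norm along a
  geodesic through \<open>x\<close> with velocity \<open>u\<close>.\<close>

lemma Gam_radial:
  fixes x u :: "'a::euclidean_space"
  assumes "x \<noteq> 0"
  defines "r \<equiv> norm x"
  shows "u \<bullet> u - x \<bullet> Gam x u u = (rho x u)\<^sup>2 + tau x u * f r * f1 r / r"
proof -
  have r: "r > 0" "x \<bullet> x = r\<^sup>2" using assms by (auto simp: power2_norm_eq_inner)
  have *: "x \<bullet> u = r * rho x u" "u \<bullet> u = tau x u + (rho x u)\<^sup>2"
    using r by (simp_all add: rho_def tau_def r_def)
  show ?thesis
    unfolding Gam_def inner_add_right inner_scaleR_right r_def[symmetric] * r(2)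
    using r(1) by (simp add: S_def Q_def field_simps eval_nat_numeral)
qed

text \<open>The geodesic equation at a single parameter, with two-sided derivatives and away from
  the origin, where the Christoffel symbols are explicit.\<close>

definition geodesic_at :: "(real \<Rightarrow> 'a::euclidean_space) \<Rightarrow> (real \<Rightarrow> 'a) \<Rightarrow> real \<Rightarrow> bool" where
  "geodesic_at c c' t \<longleftrightarrow> c t \<noteq> 0 \<and> (c has_vector_derivative c' t) (at t) \<and>
     (c' has_vector_derivative - Gam (c t) (c' t) (c' t)) (at t)"

lemma geodesic_atI:
  fixes c :: "real \<Rightarrow> 'a::euclidean_space"
  assumes "geodesic_on g I c c'" "t \<in> interior I" "c t \<noteq> 0"
  shows "geodesic_at c c' t"
proof -
  have "t \<in> I" using assms(2) interior_subset by blast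
  then show ?thesis
    using assms at_within_interior[OF assms(2)] christoffel_eq[OF assms(3)]
    unfolding geodesic_on_def geodesic_at_def by metis
qed

context
  fixes c c' :: "real \<Rightarrow> 'a::euclidean_space" and t r :: real
  assumes geo: "geodesic_at c c' t"
  defines "r \<equiv> norm (c t)"
begin

lemma geodesic_r: "r > 0" "f r > 0" "c t \<bullet> c t = r\<^sup>2"
  using geo f_pos by (auto simp: r_def geodesic_at_def power2_norm_eq_inner)

lemma inner_velocity: "c t \<bullet> c' t = r * rho (c t) (c' t)"
  using geodesic_r by (simp add: rho_def r_def)

lemma inner_velocity_velocity: "c' t \<bullet> c' t = tau (c t) (c' t) + (rho (c t) (c' t))\<^sup>2"
  by (simp add: tau_def)

lemma geodesic_norm_deriv: "((\<lambda>s. norm (c s)) has_real_derivative rho (c t) (c' t)) (at t)"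
proof -
  have "(norm has_derivative (\<lambda>h. (h \<bullet> c t) / norm (c t))) (at (c t))"
    using geo by (intro norm_has_derivative) (auto simp: geodesic_at_def)
  moreover have "(c has_derivative (\<lambda>h. h *\<^sub>R c' t)) (at t)"
    using geo by (simp add: geodesic_at_def has_vector_derivative_def)
  ultimately have "((\<lambda>s. norm (c s)) has_derivative (\<lambda>h. (h *\<^sub>R c' t) \<bullet> c t / norm (c t))) (at t)"
    using has_derivative_compose by blast
  then show ?thesis
    unfolding has_field_derivative_def
    by (rule has_derivative_eq_rhs) (auto simp: rho_def inner_commute)
qed

lemma geodesic_inner_deriv: "((\<lambda>s. c s \<bullet> z) has_real_derivative c' t \<bullet> z) (at t)"
  using geo bounded_linear.has_vector_derivative[OF bounded_linear_inner_left[of z], of c "c' t" "at t"]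
  by (simp add: geodesic_at_def has_real_derivative_iff_has_vector_derivative)

lemma geodesic_inner_deriv2:
  "((\<lambda>s. c' s \<bullet> z) has_real_derivative
     - 2 * P r * r * rho (c t) (c' t) * (c' t \<bullet> z) - (Q r * tau (c t) (c' t) - 2 * P r * (rho (c t) (c' t))\<^sup>2) * (c t \<bullet> z)) (at t)"
proof -
  have "((\<lambda>s. c' s \<bullet> z) has_real_derivative - Gam (c t) (c' t) (c' t) \<bullet> z) (at t)"
    using geo bounded_linear.has_vector_derivative[OF bounded_linear_inner_left[of z], of c' _ "at t"]
    by (simp only: geodesic_at_def has_real_derivative_iff_has_vector_derivative)
  moreover have "- Gam (c t) (c' t) (c' t) \<bullet> z = - 2 * P r * r * rho (c t) (c' t) * (c' t \<bullet> z)
      - (Q r * tau (c t) (c' t) - 2 * P r * (rho (c t) (c' t))\<^sup>2) * (c t \<bullet> z)"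
    unfolding Gam_def inner_minus_left inner_add_left inner_scaleR_left r_def[symmetric]
      inner_velocity inner_velocity_velocity
    using geodesic_r(1) by (simp add: S_def field_simps eval_nat_numeral)
  ultimately show ?thesis by simp
qed

text \<open>Differentiate \<open>r * rho = c \<bullet> c'\<close>: by \<open>Gam_radial\<close> the
  term \<open>rho\<close> squared occurs on both sides and cancels, leaving the centrifugal
  term.\<close>

lemma geodesic_rho_deriv:
  "((\<lambda>s. rho (c s) (c' s)) has_real_derivative tau (c t) (c' t) * f r * f1 r / r\<^sup>2) (at t)"
proof -
  have "((\<lambda>s. c s \<bullet> c' s) has_real_derivative c t \<bullet> - Gam (c t) (c' t) (c' t) + c' t \<bullet> c' t) (at t)"
    using geo bounded_bilinear.has_vector_derivative[OF bounded_bilinear_inner,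
        of c "c' t" t UNIV c' "- Gam (c t) (c' t) (c' t)"]
    by (simp add: geodesic_at_def has_real_derivative_iff_has_vector_derivative)
  also have "c t \<bullet> - Gam (c t) (c' t) (c' t) + c' t \<bullet> c' t = (rho (c t) (c' t))\<^sup>2 + tau (c t) (c' t) * f r * f1 r / r"
    using Gam_radial[of "c t" "c' t"] geodesic_r(1) by (simp add: r_def inner_minus_right)
  finally show ?thesis
    unfolding rho_def using geodesic_r
    by (auto intro!: derivative_eq_intros geodesic_norm_deriv simp: r_def[symmetric])
       (simp add: rho_def r_def[symmetric] field_simps power2_eq_square)
qed

end

end


section \<open>Growth of the warping function under the curvature bound\<close>

locale curved_warping = warping +
  fixes k :: real
  assumes k_pos: "k > 0"
    and f2_ge: "0 < t \<Longrightarrow> k\<^sup>2 * f t \<le> f2 t"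
begin

lemma f_continuous: "continuous_on {0..} f"
  by (rule DERIV_continuous_on) (use f_deriv_within in auto)

lemma f1_ge_1: "1 \<le> f1 t" if "0 \<le> t"
proof -
  have "0 \<le> f2 s" if "0 < s" for s
    using f2_ge[OF that] f_pos[OF that] k_pos by (smt (verit) mult_nonneg_nonneg zero_le_power2)
  then show ?thesis using halfline_mono[OF order_refl that f1_deriv_within] f1_0 by simp
qed

lemma f_ge: "t \<le> f t" if "0 \<le> t"
proof -
  have "((\<lambda>t. f t - t) has_real_derivative f1 s - 1) (at s within {0..})" if "0 \<le> s" for s
    using that by (auto intro!: derivative_eq_intros f_deriv_within)
  from halfline_mono[OF order_refl that this] show ?thesis using f1_ge_1 f_0 by auto
qed

lemma f2_nonneg: "0 < s \<Longrightarrow> 0 \<le> f2 s"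
  using f2_ge f_pos k_pos by (smt (verit) mult_nonneg_nonneg zero_le_power2)

lemma f_le: "f t \<le> t * f1 t" if "0 \<le> t"
proof -
  have "((\<lambda>t. t * f1 t - f t) has_real_derivative s * f2 s) (at s within {0..})" if "0 \<le> s" for s
    using that by (auto intro!: derivative_eq_intros f_deriv_within f1_deriv_within)
  from halfline_mono[OF order_refl that this] show ?thesis using f2_nonneg f_0 by auto
qed

text \<open>The derivative of \<open>f * f1\<close> is at least \<open>1 + (k * s)\<^sup>2\<close>,
  because \<open>f1 \<ge> 1\<close> and \<open>f s \<ge> s\<close>, and this is at least
  \<open>2 * k * s\<close>.\<close>

lemma f_f1_ge: "k * t\<^sup>2 \<le> f t * f1 t" if "0 \<le> t"
proof -
  have "0 \<le> f1 s * f1 s + f s * f2 s - 2 * k * s" if s: "0 < s" for s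
  proof -
    have "1 \<le> f1 s * f1 s" using f1_ge_1[of s] s mult_mono[of 1 "f1 s" 1 "f1 s"] by auto
    moreover have "(k * s)\<^sup>2 \<le> k\<^sup>2 * (f s * f s)"
      using f_ge[of s] s k_pos by (auto simp: power2_eq_square intro!: mult_mono)
    moreover have "k\<^sup>2 * (f s * f s) \<le> f s * f2 s"
      using mult_left_mono[OF f2_ge[OF s], of "f s"] f_pos[OF s] by (simp add: algebra_simps)
    moreover have "2 * (k * s) \<le> 1 + (k * s)\<^sup>2"
      using zero_le_power2[of "1 - k * s"] by (simp add: power2_diff)
    ultimately show ?thesis by linarith
  qed
  moreover have "((\<lambda>t. f t * f1 t - k * t\<^sup>2) has_real_derivative f1 s * f1 s + f s * f2 s - 2 * k * s)
      (at s within {0..})" if "0 \<le> s" for s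
    using that by (auto intro!: derivative_eq_intros f_deriv_within f1_deriv_within)
  ultimately show ?thesis
    using halfline_mono[OF order_refl that, of "\<lambda>t. f t * f1 t - k * t\<^sup>2"] f_0 by fastforce
qed

text \<open>The radial part of \<open>u\<close> keeps its Euclidean length, and the tangential part
  is stretched by \<open>f r / r \<ge> 1\<close>.\<close>

lemma metric_ge: "u \<bullet> u \<le> g x u u"
proof (cases "x = 0")
  case False
  then have "1 \<le> (f (norm x) / norm x)\<^sup>2"
    using f_ge[of "norm x"] by (simp add: power_divide power_mono)
  then have "tau x u \<le> (f (norm x) / norm x)\<^sup>2 * tau x u"
    using mult_right_mono[OF _ tau_nonneg[of x u], of 1] by simp
  then show ?thesis
    by (simp add: metric_rho_tau[OF False] tau_def)
qed (simp add: metric_0)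

text \<open>\<open>h1\<close> and \<open>h2\<close> are the first two derivatives of \<open>h\<close> along a geodesic with velocity \<open>u\<close>.\<close>

definition h :: "real \<Rightarrow> 'a::euclidean_space \<Rightarrow> 'a \<Rightarrow> real" where
  "h a e x = f (norm x) / norm x * (x \<bullet> e - 1 / k) - a * f (norm x)"

definition h1 :: "real \<Rightarrow> 'a::euclidean_space \<Rightarrow> 'a \<Rightarrow> 'a \<Rightarrow> real" where
  "h1 a e x u = (f1 (norm x) / norm x - f (norm x) / (norm x)\<^sup>2) * rho x u * (x \<bullet> e - 1 / k)
     + f (norm x) / norm x * (u \<bullet> e) - a * f1 (norm x) * rho x u"

definition h2 :: "real \<Rightarrow> 'a::euclidean_space \<Rightarrow> 'a \<Rightarrow> 'a \<Rightarrow> real" where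
  "h2 a e x u = (let r = norm x; s = (x \<bullet> e - 1 / k) / r - a in
     (rho x u)\<^sup>2 * (f2 r * s + 2 / k * (r * f1 r - f r) / r ^ 3)
     + tau x u * f r / r\<^sup>2 * ((f1 r)\<^sup>2 * s - (x \<bullet> e) / r + f r * f1 r / (k * r\<^sup>2)))"

section \<open>Convexity of \<open>h\<close> along geodesics\<close>

lemma h_deriv:
  fixes c :: "real \<Rightarrow> 'a::euclidean_space"
  assumes geo: "geodesic_at c c' t"
  shows "((\<lambda>s. h a e (c s)) has_real_derivative h1 a e (c t) (c' t)) (at t)"
proof -
  note r = geodesic_r[OF geo]
  note D = DERIV_chain2[OF f_deriv[OF r(1)] geodesic_norm_deriv[OF geo]]
    geodesic_norm_deriv[OF geo] geodesic_inner_deriv[OF geo]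
  show ?thesis
    unfolding h_def h1_def using r k_pos
    by (auto intro!: derivative_eq_intros D) (simp add: field_simps power2_eq_square)
qed

lemma h1_deriv:
  fixes c :: "real \<Rightarrow> 'a::euclidean_space"
  assumes geo: "geodesic_at c c' t"
  shows "((\<lambda>s. h1 a e (c s) (c' s)) has_real_derivative h2 a e (c t) (c' t)) (at t)"
proof -
  note r = geodesic_r[OF geo]
  note D = DERIV_chain2[OF f_deriv[OF r(1)] geodesic_norm_deriv[OF geo]]
    DERIV_chain2[OF f1_deriv[OF r(1)] geodesic_norm_deriv[OF geo]]
    geodesic_norm_deriv[OF geo] geodesic_inner_deriv[OF geo]
    geodesic_inner_deriv2[OF geo] geodesic_rho_deriv[OF geo]
  \<comment> \<open>\<open>Y\<close> is the derivative of \<open>f r / r\<close>; as a single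
    function it can be fed to the chain rule.\<close>
  define Y where "Y r = f1 r / r - f r / r\<^sup>2" for r
  let ?r = "norm (c t)"
  have "(Y has_real_derivative f2 ?r / ?r - 2 * f1 ?r / ?r\<^sup>2 + 2 * f ?r / ?r ^ 3) (at ?r)"
    unfolding Y_def using r(1)
    by (auto intro!: derivative_eq_intros f_deriv f1_deriv) (simp add: field_simps eval_nat_numeral)
  note D = D DERIV_chain2[OF this geodesic_norm_deriv[OF geo]]
  show ?thesis
    unfolding h1_def Y_def[symmetric]
    by (rule DERIV_cong, (rule derivative_intros D | (use r in simp; fail))+)
       (use r(1,2) k_pos in \<open>simp add: h2_def Let_def Y_def P_def Q_def field_simps eval_nat_numeral\<close>)
qed

text \<open>Since \<open>h = f r * s\<close>, the assumption says \<open>s \<ge> 0\<close>. The only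
  negative contribution is \<open>- (x \<bullet> e) / r \<ge> - 1\<close>, and the offset
  \<open>1 / k\<close> in \<open>h\<close> produces
  \<open>f r * f1 r / (k * r\<^sup>2) \<ge> 1\<close> to absorb it; this is the origin of the
  constant \<open>1 / k\<close>.\<close>

lemma h2_nonneg:
  assumes "norm e = 1" "x \<noteq> 0" "h a e x \<ge> 0"
  shows "h2 a e x u \<ge> 0"
proof -
  define r where "r = norm x"
  define s where "s = (x \<bullet> e - 1 / k) / r - a"
  have r: "r > 0" "f r > 0" using assms f_pos by (auto simp: r_def)
  have "h a e x = f r * s"
    using r by (simp add: h_def s_def r_def[symmetric] field_simps)
  then have s: "s \<ge> 0" using assms r by (simp add: zero_le_mult_iff)
  have "(x \<bullet> e) / r \<le> 1"
    using norm_cauchy_schwarz[of x e] assms r by (simp add: r_def)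
  moreover have "1 \<le> f r * f1 r / (k * r\<^sup>2)"
    using f_f1_ge[of r] r k_pos by (simp add: field_simps)
  moreover have "(f1 r)\<^sup>2 * s \<ge> 0" using s by simp
  ultimately have A: "(f1 r)\<^sup>2 * s - (x \<bullet> e) / r + f r * f1 r / (k * r\<^sup>2) \<ge> 0" by linarith
  have B: "f2 r * s + 2 / k * (r * f1 r - f r) / r ^ 3 \<ge> 0"
    using f2_nonneg[of r] f_le[of r] r s k_pos by (intro add_nonneg_nonneg) auto
  have C: "tau x u * f r / r\<^sup>2 \<ge> 0" using tau_nonneg[of x u] r by simp
  show ?thesis
    unfolding h2_def Let_def r_def[symmetric] s_def[symmetric]
    by (rule add_nonneg_nonneg[OF mult_nonneg_nonneg[OF zero_le_power2 B] mult_nonneg_nonneg[OF C A]])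
qed


text \<open>\<open>h2_nonneg\<close> controls \<open>h\<close> only where it is nonnegative, so the
  maximum principle is applied on the compact set \<open>T\<close> of times spent in the closed
  region.\<close>

lemma convex_complement:
  fixes e :: "'a::euclidean_space"
  assumes e: "norm e = 1"
  shows "geodesically_convex g (- {x. a * norm x + 1 / k < x \<bullet> e})"
  unfolding geodesically_convex_def
proof (intro allI impI, elim conjE)
  fix c c' :: "real \<Rightarrow> 'a"
  assume geo: "geodesic_on g {0..1} c c'"
    and ends: "c 0 \<in> - {x. a * norm x + 1 / k < x \<bullet> e}" "c 1 \<in> - {x. a * norm x + 1 / k < x \<bullet> e}"
  have h_pos: "0 < h a e x \<longleftrightarrow> a * norm x + 1 / k < x \<bullet> e" if "x \<noteq> 0" for x
  proof -
    have "h a e x = f (norm x) / norm x * (x \<bullet> e - 1 / k - a * norm x)"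
      using that by (simp add: h_def field_simps)
    moreover have "f (norm x) / norm x > 0" using that f_pos by simp
    ultimately show ?thesis by (simp only: zero_less_mult_iff simp_thms) linarith
  qed
  \<comment> \<open>The positive offset \<open>1 / k\<close> keeps the origin, where
    \<open>h\<close> divides by zero, out of the closed region.\<close>
  have nz: "c t \<noteq> 0" if "a * norm (c t) + 1 / k \<le> c t \<bullet> e" for t
    using that k_pos by auto
  have cont: "continuous_on {0..1} c"
    by (rule continuous_on_vector_derivative[of _ c c']) (use geo in \<open>simp add: geodesic_on_def\<close>)
  show "c ` {0..1} \<subseteq> - {x. a * norm x + 1 / k < x \<bullet> e}"
  proof (rule ccontr)
    assume "\<not> ?thesis"
    then obtain t0 where "t0 \<in> {0..1}" "c t0 \<notin> - {x. a * norm x + 1 / k < x \<bullet> e}" by blast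
    then have t0: "t0 \<in> {0..1}" "a * norm (c t0) + 1 / k < c t0 \<bullet> e" by simp_all
    define \<epsilon> where "\<epsilon> = h a e (c t0)"
    have \<epsilon>: "\<epsilon> > 0" using h_pos nz t0 by (simp add: \<epsilon>_def)
    define T where "T = {t \<in> {0..1}. a * norm (c t) + 1 / k \<le> c t \<bullet> e}"
    \<comment> \<open>The perturbation makes the second derivative at a maximum strictly positive.\<close>
    define \<phi> where "\<phi> t = h a e (c t) - \<epsilon> * (t * (1 - t))" for t
    have "T = {0..1} \<inter> (\<lambda>t. c t \<bullet> e - (a * norm (c t) + 1 / k)) -` {0..}"
      by (auto simp: T_def)
    moreover have "closed ({0..1} \<inter> (\<lambda>t. c t \<bullet> e - (a * norm (c t) + 1 / k)) -` {0..})"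
      by (rule continuous_closed_preimage) (auto intro!: continuous_intros cont)
    ultimately have "closed T" by simp
    moreover have "T \<inter> {0..1} = T" by (auto simp: T_def)
    ultimately have "compact T"
      using closed_Int_compact[OF _ compact_Icc[of 0 1], of T] by simp
    have "continuous_on T c" using cont by (rule continuous_on_subset) (auto simp: T_def)
    moreover have "continuous_on T (\<lambda>t. f (norm (c t)))"
      by (rule continuous_on_compose2[OF f_continuous]) (auto intro!: continuous_intros calculation)
    ultimately have "continuous_on T \<phi>"
      unfolding \<phi>_def h_def by (intro continuous_intros) (auto simp: T_def nz)
    have "t0 \<in> T" using t0 by (simp add: T_def)
    obtain s where s: "s \<in> T" "\<And>t. t \<in> T \<Longrightarrow> \<phi> t \<le> \<phi> s"
      using continuous_attains_sup[OF \<open>compact T\<close> _ \<open>continuous_on T \<phi>\<close>] \<open>t0 \<in> T\<close> by blast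
    \<comment> \<open>The perturbation is too small to destroy positivity at \<open>t0\<close>.
      Hence \<open>h\<close> is positive at the maximum point of \<open>\<phi>\<close>, which
      therefore lies in the open region and away from both end times.\<close>
    have "t0 * (1 - t0) < 1"
      using zero_le_power2[of "2 * t0 - 1"] by (simp add: power2_eq_square algebra_simps)
    then have "\<epsilon> * (t0 * (1 - t0)) < \<epsilon>" using mult_strict_left_mono[OF _ \<epsilon>] by fastforce
    then have "0 < \<phi> t0" by (simp only: \<phi>_def \<epsilon>_def)
    also have "\<phi> t0 \<le> \<phi> s" using s \<open>t0 \<in> T\<close> by blast
    also have "\<phi> s \<le> h a e (c s)"
      using s(1) \<epsilon> by (simp add: \<phi>_def T_def)
    finally have hs: "0 < h a e (c s)" .
    with s(1) h_pos nz have inside: "a * norm (c s) + 1 / k < c s \<bullet> e" by (auto simp: T_def)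
    with ends s(1) have s01: "0 < s" "s < 1" by (auto simp: T_def order.strict_iff_order)
    have "continuous_on {0<..<1} (\<lambda>t. c t \<bullet> e - (a * norm (c t) + 1 / k))"
      by (intro continuous_intros continuous_on_subset[OF cont]) auto
    then have "open ({0<..<1} \<inter> (\<lambda>t. c t \<bullet> e - (a * norm (c t) + 1 / k)) -` {0<..})"
      by (rule continuous_open_preimage) auto
    moreover have "s \<in> {0<..<1} \<inter> (\<lambda>t. c t \<bullet> e - (a * norm (c t) + 1 / k)) -` {0<..}"
      using inside s01 by simp
    ultimately obtain d where "d > 0"
      and ball: "ball s d \<subseteq> {0<..<1} \<inter> (\<lambda>t. c t \<bullet> e - (a * norm (c t) + 1 / k)) -` {0<..}"
      using open_contains_ball by metis
    then have d: "d > 0" "a * norm (c t) + 1 / k < c t \<bullet> e \<and> 0 < t \<and> t < 1" if "\<bar>t - s\<bar> < d" for t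
      using subsetD[OF ball, of t] that by (auto simp: dist_real_def abs_minus_commute)
    have geo_at: "geodesic_at c c' t" if "\<bar>t - s\<bar> < d" for t
      using d(2)[OF that] nz[of t] by (intro geodesic_atI[OF geo]) auto
    show False
    proof (rule not_local_max_if_second_deriv_pos[OF \<open>d > 0\<close>, of s \<phi>])
      fix t assume t: "\<bar>t - s\<bar> < d"
      show "(\<phi> has_real_derivative (\<lambda>t. h1 a e (c t) (c' t) - \<epsilon> * (1 - 2 * t)) t) (at t)"
        unfolding \<phi>_def by (auto intro!: derivative_eq_intros h_deriv geo_at t simp: algebra_simps)
      show "\<phi> t \<le> \<phi> s" using s(2) d(2)[OF t] by (auto simp: T_def)
    next
      show "((\<lambda>t. h1 a e (c t) (c' t) - \<epsilon> * (1 - 2 * t)) has_real_derivative h2 a e (c s) (c' s) + 2 * \<epsilon>) (at s)"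
        using \<open>d > 0\<close> by (auto intro!: derivative_eq_intros h1_deriv geo_at)
      show "0 < h2 a e (c s) (c' s) + 2 * \<epsilon>"
        using h2_nonneg[OF e, of "c s" a "c' s"] hs \<epsilon> nz inside by force
    qed
  qed
qed

end

section \<open>Geodesic rays from the origin\<close>

context curved_warping
begin

text \<open>Attaches to each ray from the center its initial unit vector, which determines it on the
  half-line; points at infinity are handled through this vector.\<close>

lemma unit_ray_from_origin:
  fixes c :: "real \<Rightarrow> 'a::euclidean_space"
  assumes ray: "unit_ray g c c'" and c0: "c 0 = 0"
  shows "norm (c' 0) = 1" "\<And>t. 0 \<le> t \<Longrightarrow> c t = t *\<^sub>R c' 0"
proof -
  have geo: "geodesic_on g {0..} c c'" and unit: "\<And>t. 0 \<le> t \<Longrightarrow> g (c t) (c' t) (c' t) = 1"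
    using ray by (auto simp: unit_ray_def)
  have dc: "(c has_vector_derivative c' t) (at t within {0..})" 
    and dc': "(c' has_vector_derivative - christoffel g (c t) (c' t) (c' t)) (at t within {0..})"
    if "0 \<le> t" for t
    using geo that by (auto simp: geodesic_on_def)
  show n0: "norm (c' 0) = 1"
    using unit[of 0] c0 by (simp add: metric_0 norm_eq_1)
  \<comment> \<open>\<open>\<bar>c\<bar>\<^sup>2\<close> is convex, so the ray never returns to the origin.\<close>
  have dq: "((\<lambda>t. c t \<bullet> c' t) has_real_derivative
      (c t \<bullet> - christoffel g (c t) (c' t) (c' t) + c' t \<bullet> c' t)) (at t within {0..})" if "0 \<le> t" for t
    using bounded_bilinear.has_vector_derivative[OF bounded_bilinear_inner dc[OF that] dc'[OF that]]
    by (simp add: has_real_derivative_iff_has_vector_derivative)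
  \<comment> \<open>At a zero of \<open>c\<close> the acceleration is multiplied by 0; elsewhere
    \<open>Gam_radial\<close> gives a sum of nonnegative terms.\<close>
  have "c t \<bullet> - christoffel g (c t) (c' t) (c' t) + c' t \<bullet> c' t \<ge> 0" if "0 < t" for t
  proof (cases "c t = 0")
    case False
    have "(rho (c t) (c' t))\<^sup>2 + tau (c t) (c' t) * f (norm (c t)) * f1 (norm (c t)) / norm (c t) \<ge> 0"
      using f_pos[of "norm (c t)"] f1_ge_1[of "norm (c t)"] tau_nonneg False
      by (intro add_nonneg_nonneg divide_nonneg_nonneg mult_nonneg_nonneg) auto
    then show ?thesis
      using Gam_radial[OF False] by (simp add: christoffel_eq[OF False])
  qed simp
  from halfline_mono[OF order_refl _ dq this] c0
  have q: "0 \<le> c t \<bullet> c' t" if "0 \<le> t" for t using that by simp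
  have dn: "((\<lambda>t. c t \<bullet> c t) has_real_derivative 2 * (c t \<bullet> c' t)) (at t within {0..})" if "0 \<le> t" for t
    using bounded_bilinear.has_vector_derivative[OF bounded_bilinear_inner dc[OF that] dc[OF that]]
    by (simp add: has_real_derivative_iff_has_vector_derivative inner_commute)
  have mono: "c s \<bullet> c s \<le> c t \<bullet> c t" if "0 \<le> s" "s \<le> t" for s t
    by (rule halfline_mono[OF that, of _ "\<lambda>t. 2 * (c t \<bullet> c' t)"]) (use that q dn in auto)
  have at: "at t within {0..} = at t" if "0 < t" for t :: real
    using that by (intro at_within_interior) auto
  \<comment> \<open>By monotonicity a return to the origin forces \<open>c\<close> to rest there on
    a whole interval, against unit speed.\<close>
  have nz: "c t \<noteq> 0" if t: "0 < t" for t
  proof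
    assume "c t = 0"
    then have z: "c s = 0" if "s \<in> {0<..<t}" for s
      using mono[of s t] that \<open>c t = 0\<close> inner_ge_zero[of "c s"] inner_eq_zero_iff[of "c s"] by (simp del: inner_ge_zero inner_eq_zero_iff)
    have "((\<lambda>_. 0) has_vector_derivative c' (t/2)) (at (t/2))"
      by (rule has_vector_derivative_transform_within_open[of c _ _ "{0<..<t}"])
         (use dc[of "t/2"] at[of "t/2"] t z in auto)
    then have "c' (t/2) = 0"
      using vector_derivative_unique_at has_vector_derivative_const by blast
    then show False using unit[of "t/2"] t z[of "t/2"] by (simp add: metric_0)
  qed
  have geo_at: "geodesic_at c c' t" if "0 < t" for t
    using that nz by (intro geodesic_atI[OF geo]) auto
  have rho_sq: "(rho (c t) (c' t))\<^sup>2 + (f (norm (c t)) / norm (c t))\<^sup>2 * tau (c t) (c' t) = 1" if "0 < t" for t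
    using unit[of t] metric_rho_tau[OF nz[OF that]] that by simp
  have rho_le: "rho (c t) (c' t) \<le> 1" if "0 < t" for t
  proof -
    have "(rho (c t) (c' t))\<^sup>2 \<le> 1\<^sup>2"
      using rho_sq[OF that] tau_nonneg[of "c t" "c' t"] by (smt (verit) mult_nonneg_nonneg zero_le_power2 one_power2)
    then show ?thesis by (rule power2_le_imp_le) simp
  qed
  have rho_mono: "rho (c s) (c' s) \<le> rho (c t) (c' t)" if "0 < s" "s \<le> t" for s t
  proof (rule halfline_mono[where \<phi>="\<lambda>t. rho (c t) (c' t)"
        and \<phi>' = "\<lambda>t. tau (c t) (c' t) * f (norm (c t)) * f1 (norm (c t)) / (norm (c t))\<^sup>2"])
    show "((\<lambda>t. rho (c t) (c' t)) has_real_derivative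
         tau (c x) (c' x) * f (norm (c x)) * f1 (norm (c x)) / (norm (c x))\<^sup>2) (at x within {0..})" if "s \<le> x" for x
      using geodesic_rho_deriv[OF geo_at[of x]] that \<open>0 < s\<close> by (simp add: has_field_derivative_at_within)
    show "0 \<le> tau (c x) (c' x) * f (norm (c x)) * f1 (norm (c x)) / (norm (c x))\<^sup>2" if "s < x" for x
      using f_pos[of "norm (c x)"] f1_ge_1[of "norm (c x)"] tau_nonneg[of "c x" "c' x"] nz[of x] that \<open>0 < s\<close>
      by (intro divide_nonneg_nonneg mult_nonneg_nonneg) auto
  qed (use that in auto)
  have cont: "continuous_on {0..} c"
    using dc by (auto simp: continuous_on_eq_continuous_within intro: has_vector_derivative_continuous)
  have radial_speed: "\<exists>z\<in>{0<..<t}. norm (c t) = t * rho (c z) (c' z)" if t: "0 < t" for t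
  proof -
    have "continuous_on {0..t} (\<lambda>t. norm (c t))"
      by (intro continuous_intros continuous_on_subset[OF cont]) auto
    moreover have "((\<lambda>t. norm (c t)) has_derivative (*) (rho (c z) (c' z))) (at z)" if "0 < z" for z
      using geodesic_norm_deriv[OF geo_at[OF that]] by (simp add: has_field_derivative_def)
    ultimately obtain z where "z \<in> {0<..<t}" "norm (c t) - norm (c 0) = rho (c z) (c' z) * (t - 0)"
      using mvt[OF t, of "\<lambda>t. norm (c t)" "\<lambda>z. (*) (rho (c z) (c' z))"]
      by (metis greaterThanLessThan_iff)
    then show ?thesis by (auto simp: c0 mult.commute)
  qed
  \<comment> \<open>A radial speed \<open>b < 1\<close> at \<open>t\<close> bounds all earlier ones,
    so \<open>norm (c s) \<le> b * s\<close> for \<open>s \<le> t\<close>. But \<open>c s\<close>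
    differs from \<open>s *\<^sub>R c' 0\<close>, of norm \<open>s\<close>, by at most half the gap
    \<open>(1 - b) * s\<close> when \<open>s\<close> is small.\<close>
  have rho_1: "rho (c t) (c' t) = 1" if t: "0 < t" for t
  proof (rule ccontr)
    define b where "b = rho (c t) (c' t)"
    assume "rho (c t) (c' t) \<noteq> 1"
    then have b: "b < 1" using rho_le[OF t] by (simp add: b_def)
    have small: "norm (c s) \<le> b * s" if "0 < s" "s \<le> t" for s
    proof -
      obtain z where z: "0 < z" "z < s" "norm (c s) = s * rho (c z) (c' z)"
        using radial_speed[OF \<open>0 < s\<close>] by auto
      then show ?thesis using rho_mono[of z t] that by (simp add: b_def mult.commute mult_left_mono)
    qed
    obtain d where d: "d > 0" "\<And>s. 0 \<le> s \<Longrightarrow> s < d \<Longrightarrow> norm (c s - s *\<^sub>R c' 0) \<le> (1 - b) / 2 * s"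
      using dc[of 0] b unfolding has_vector_derivative_def has_derivative_within_alt
      by (auto simp: c0 dest!: spec[of _ "(1 - b) / 2"])
    define s where "s = min t d / 2"
    have s: "0 < s" "s \<le> t" "s < d" using t d by (auto simp: s_def)
    have "s = norm (s *\<^sub>R c' 0)" using n0 s by simp
    also have "\<dots> \<le> norm (c s) + norm (c s - s *\<^sub>R c' 0)"
      by (metis norm_triangle_sub norm_minus_commute)
    also have "\<dots> \<le> b * s + (1 - b) / 2 * s" using small[of s] d(2)[of s] s by linarith
    finally have "s * ((1 - b) / 2) \<le> 0" by (simp add: field_simps)
    with s b show False by (simp add: mult_le_0_iff)
  qed
  have R: "norm (c t) = t" if "0 < t" for t
    using radial_speed[OF that] rho_1 by auto
  \<comment> \<open>Radial speed 1 exhausts the unit speed and leaves no tangential part, so the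
    velocity is the radial unit vector.\<close>
  have c'_eq: "c' t = (1 / t) *\<^sub>R c t" if t: "0 < t" for t
  proof -
    have "tau (c t) (c' t) = 0"
      using rho_sq[OF t] rho_1[OF t] f_pos[of t] R[OF t] t by simp
    then have "c' t \<bullet> c' t = 1" using rho_1[OF t] by (simp add: tau_def)
    moreover have "c t \<bullet> c' t = t" using rho_1[OF t] R[OF t] t by (simp add: rho_def)
    moreover have "c t \<bullet> c t = t\<^sup>2" using R[OF t] by (simp flip: power2_norm_eq_inner)
    ultimately have "(c' t - (1 / t) *\<^sub>R c t) \<bullet> (c' t - (1 / t) *\<^sub>R c t) = 0"
      using t by (simp add: inner_diff_left inner_diff_right inner_commute power2_eq_square)
    then show ?thesis by simp
  qed
  \<comment> \<open>Hence \<open>c t / t\<close> is a constant \<open>w\<close>, and the derivative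
    of \<open>c\<close> at 0 identifies \<open>w\<close> with \<open>c' 0\<close>.\<close>
  have "((\<lambda>t. (1 / t) *\<^sub>R c t) has_vector_derivative 0) (at t within {0<..})" if t: "t \<in> {0<..}" for t
  proof -
    have "(c has_vector_derivative c' t) (at t)" using dc[of t] at[of t] t by simp
    then have "((\<lambda>t. (1 / t) *\<^sub>R c t) has_vector_derivative ((1 / t) *\<^sub>R c' t + (- (1 / t\<^sup>2)) *\<^sub>R c t)) (at t)"
      using t by (intro has_vector_derivative_scaleR)
         (auto intro!: derivative_eq_intros simp: power2_eq_square)
    then show ?thesis
      using c'_eq[of t] t by (simp add: power2_eq_square has_vector_derivative_at_within)
  qed
  then obtain w where w: "\<And>t. 0 < t \<Longrightarrow> (1 / t) *\<^sub>R c t = w"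
    using has_vector_derivative_zero_constant[of "{0<..}" "\<lambda>t. (1 / t) *\<^sub>R c t"] by auto
  have cw: "c t = t *\<^sub>R w" if "0 \<le> t" for t
    using w[of t] that c0 by (cases "t = 0") (auto simp: field_simps)
  have "(c has_vector_derivative w) (at 0 within {0..})"
    by (rule has_vector_derivative_transform[of _ _ _ "\<lambda>t. t *\<^sub>R w"])
       (auto simp: cw intro!: derivative_eq_intros)
  then have "c' 0 = w"
    using dc[of 0] by (intro vector_derivative_unique_within_closed_interval[of 0 1 0 c])
      (auto intro: has_vector_derivative_within_subset)
  then show "c t = t *\<^sub>R c' 0" if "0 \<le> t" for t
    using cw that by simp
qed

text \<open>The velocity integrates to the Euclidean displacement, and by \<open>metric_ge\<close>
  its Euclidean norm is at most the Riemannian speed.\<close>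

lemma riem_dist_ge:
  fixes x y :: "'a::euclidean_space"
  assumes rm: "riemannian_metric (g :: 'a tensor)"
  shows "dist x y \<le> riem_dist g x y"
  unfolding riem_dist_def
proof (rule cInf_greatest)
  have cont: "continuous_on UNIV (\<lambda>z. g z u v)" for u v :: 'a
  proof -
    have "Ck_on 0 UNIV (\<lambda>z. g z u v)"
      using rm unfolding riemannian_metric_def smooth_on_def by blast
    then show ?thesis by simp
  qed
  \<comment> \<open>The segment has continuous speed, hence a length; so the infimum is over a
    nonempty set.\<close>
  have "continuous_on {0..1} (\<lambda>t. sqrt (g (linepath x y t) (y - x) (y - x)))"
    by (intro continuous_intros continuous_on_compose2[OF cont]) auto
  then obtain L where "((\<lambda>t. sqrt (g (linepath x y t) (y - x) (y - x))) has_integral L) {0..1}"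
    using integrable_continuous_interval unfolding integrable_on_def by blast
  then show "{L. \<exists>c. valid_path c \<and> pathstart c = x \<and> pathfinish c = y \<and>
       ((\<lambda>t. sqrt (g (c t) (vector_derivative c (at t)) (vector_derivative c (at t))))
          has_integral L) {0..1}} \<noteq> {}"
    by (auto intro!: exI[of _ L] exI[of _ "linepath x y"])
next
  fix L
  assume "L \<in> {L. \<exists>c. valid_path c \<and> pathstart c = x \<and> pathfinish c = y \<and>
       ((\<lambda>t. sqrt (g (c t) (vector_derivative c (at t)) (vector_derivative c (at t))))
          has_integral L) {0..1}}"
  then obtain c where c: "valid_path c" "c 0 = x" "c 1 = y"
    and L: "((\<lambda>t. sqrt (g (c t) (vector_derivative c (at t)) (vector_derivative c (at t)))) has_integral L) {0..1}"
    by (auto simp: pathstart_def pathfinish_def)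
  obtain N where N: "finite N" "c C1_differentiable_on {0..1} - N" and "continuous_on {0..1} c"
    using c(1) by (auto simp: valid_path_def piecewise_C1_differentiable_on_def)
  have "((\<lambda>t. vector_derivative c (at t)) has_integral c 1 - c 0) {0..1}"
  proof (rule fundamental_theorem_of_calculus_interior_strong[OF N(1)])
    fix t assume "t \<in> {0<..<1} - N"
    then show "(c has_vector_derivative vector_derivative c (at t)) (at t)"
      using N(2) by (auto simp: C1_differentiable_on_eq vector_derivative_works)
  qed (use \<open>continuous_on {0..1} c\<close> in auto)
  moreover have "norm u \<le> sqrt (g z u u)" for z u :: 'a
    using metric_ge[of u z] by (simp add: norm_eq_sqrt_inner)
  ultimately have "norm (c 1 - c 0) \<le> L"
    using integral_norm_bound_integral[of "\<lambda>t. vector_derivative c (at t)" "{0..1}"] L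
    by (metis (no_types, lifting) has_integral_integrable_integral)
  then show "dist x y \<le> L"
    using c by (simp add: dist_norm norm_minus_commute)
qed

end

section \<open>Directions at infinity and the cone topology\<close>

context curved_warping
begin

text \<open>A relation, not a function: uniqueness of \<open>w\<close> comes from
  \<open>has_dir_unique\<close>, existence from \<open>has_dir_exists\<close> for points of the
  topological space.\<close>

definition has_dir :: "'a::euclidean_space compactified \<Rightarrow> 'a \<Rightarrow> bool" where
  "has_dir \<xi> w \<longleftrightarrow> \<xi> \<in> asymptotic_boundary g \<and>
     (\<exists>C c c'. \<xi> = Inr C \<and> c \<in> C \<and> unit_ray g c c' \<and> c 0 = 0 \<and> c' 0 = w)"

lemma has_dir_norm: "has_dir \<xi> w \<Longrightarrow> norm w = 1"
  unfolding has_dir_def using unit_ray_from_origin(1) by blast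

text \<open>Two rays of one class stay at bounded Riemannian, hence Euclidean, distance from a
  common ray \<open>b\<close>, whereas distinct straight rays from the origin diverge
  linearly.\<close>

lemma has_dir_unique:
  fixes \<xi> :: "'a::euclidean_space compactified"
  assumes rm: "riemannian_metric (g :: 'a tensor)"
    and "has_dir \<xi> v" "has_dir \<xi> w"
  shows "v = w"
proof -
  obtain C c c' where C: "\<xi> = Inr C" "\<xi> \<in> asymptotic_boundary g"
    and c: "c \<in> C" "unit_ray g c c'" "c 0 = 0" "c' 0 = v"
    using assms(2) unfolding has_dir_def by blast
  obtain d d' where d: "d \<in> C" "unit_ray g d d'" "d 0 = 0" "d' 0 = w"
    using assms(3) C(1) unfolding has_dir_def by blast
  obtain b where "C = asymptotic_rays g `` {b}"
    using C by (auto simp: asymptotic_boundary_def quotient_def)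
  then have "(b, c) \<in> asymptotic_rays g" "(b, d) \<in> asymptotic_rays g"
    using c d by simp_all
  then obtain B1 B2 where
    B: "\<And>t. 0 \<le> t \<Longrightarrow> riem_dist g (b t) (c t) \<le> B1" "\<And>t. 0 \<le> t \<Longrightarrow> riem_dist g (b t) (d t) \<le> B2"
    unfolding asymptotic_rays_def by blast
  have bound: "t * norm (v - w) \<le> B1 + B2" if t: "0 \<le> t" for t
  proof -
    have "t * norm (v - w) = dist (c t) (d t)"
      using unit_ray_from_origin(2)[OF c(2,3) t] unit_ray_from_origin(2)[OF d(2,3) t] c(4) d(4) t
      by (simp add: dist_norm flip: scaleR_diff_right)
    also have "\<dots> \<le> dist (b t) (c t) + dist (b t) (d t)"
      by (rule dist_triangle3)
    also have "\<dots> \<le> B1 + B2"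
      using riem_dist_ge[OF rm, of "b t" "c t"] riem_dist_ge[OF rm, of "b t" "d t"] B[OF t] by linarith
    finally show ?thesis .
  qed
  show "v = w"
  proof (rule ccontr)
    assume "v \<noteq> w"
    then have n: "norm (v - w) > 0" by simp
    define t where "t = (\<bar>B1 + B2\<bar> + 1) / norm (v - w)"
    have "0 \<le> t" "t * norm (v - w) = \<bar>B1 + B2\<bar> + 1" using n by (auto simp: t_def)
    with bound[of t] show False by linarith
  qed
qed

section \<open>Truncated cones with vertex at the center and neighborhoods of points at
  infinity\<close>

lemma tangent_angle_origin:
  "norm v = 1 \<Longrightarrow> norm w = 1 \<Longrightarrow> tangent_angle g 0 v w = arccos (v \<bullet> w)"
  by (simp add: tangent_angle_def metric_0 norm_eq_1)

lemma Inr_in_truncated_cone_iff: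
  "Inr C \<in> truncated_cone G p v \<epsilon> R \<longleftrightarrow> Inr C \<in> asymptotic_boundary G \<and>
     (\<exists>c c'. c \<in> C \<and> unit_ray G c c' \<and> c 0 = p \<and> tangent_angle G p v (c' 0) < \<epsilon>)"
  by (simp add: truncated_cone_def)

lemma Inl_in_truncated_cone_iff:
  "Inl x \<in> truncated_cone G p v \<epsilon> R \<longleftrightarrow>
     (\<exists>c c' s. x = c s \<and> unit_ray G c c' \<and> c 0 = p \<and> tangent_angle G p v (c' 0) < \<epsilon> \<and>
        s \<ge> 0 \<and> riem_dist G p (c s) > R)"
  by (simp add: truncated_cone_def)

lemma boundary_in_truncated_cone_iff:
  assumes v: "norm v = 1" and \<xi>: "\<xi> \<in> asymptotic_boundary g"
  shows "\<xi> \<in> truncated_cone g 0 v \<epsilon> R \<longleftrightarrow> (\<exists>w. has_dir \<xi> w \<and> arccos (v \<bullet> w) < \<epsilon>)"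
proof -
  obtain C where C: "\<xi> = Inr C" using \<xi> unfolding asymptotic_boundary_def by blast
  have ang: "tangent_angle g 0 v (c' 0) = arccos (v \<bullet> c' 0)" if "unit_ray g c c'" "c 0 = 0" for c c'
    using tangent_angle_origin[OF v unit_ray_from_origin(1)[OF that]] .
  show ?thesis
  proof
    assume "\<xi> \<in> truncated_cone g 0 v \<epsilon> R"
    then obtain c c' where c: "c \<in> C" "unit_ray g c c'" "c 0 = 0" "tangent_angle g 0 v (c' 0) < \<epsilon>"
      unfolding C Inr_in_truncated_cone_iff by blast
    then have "has_dir \<xi> (c' 0)" unfolding has_dir_def using C \<xi> by blast
    then show "\<exists>w. has_dir \<xi> w \<and> arccos (v \<bullet> w) < \<epsilon>" using c ang[OF c(2,3)] by auto
  next
    assume "\<exists>w. has_dir \<xi> w \<and> arccos (v \<bullet> w) < \<epsilon>"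
    then obtain c c' where c: "c \<in> C" "unit_ray g c c'" "c 0 = 0" "arccos (v \<bullet> c' 0) < \<epsilon>"
      unfolding has_dir_def C by auto
    then have "tangent_angle g 0 v (c' 0) < \<epsilon>" using ang[OF c(2,3)] by simp
    with c \<xi> show "\<xi> \<in> truncated_cone g 0 v \<epsilon> R"
      unfolding C Inr_in_truncated_cone_iff by blast
  qed
qed

lemma point_in_truncated_cone:
  assumes v: "norm v = 1" and "Inl x \<in> truncated_cone g 0 v \<epsilon> R"
  obtains s w where "x = s *\<^sub>R w" "0 \<le> s" "norm w = 1" "arccos (v \<bullet> w) < \<epsilon>"
proof -
  obtain c c' s where c: "x = c s" "unit_ray g c c'" "c 0 = 0" "tangent_angle g 0 v (c' 0) < \<epsilon>" "0 \<le> s"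
    using assms(2) unfolding Inl_in_truncated_cone_iff by blast
  note ray = unit_ray_from_origin[OF c(2,3)]
  show ?thesis
  proof (rule that)
    show "x = s *\<^sub>R c' 0" using ray(2)[OF c(5)] c(1) by simp
    show "arccos (v \<bullet> c' 0) < \<epsilon>" using c(4) tangent_angle_origin[OF v ray(1)] by simp
  qed (fact c(5), fact ray(1))
qed

lemma point_in_truncated_coneI:
  fixes w :: "'a::euclidean_space"
  assumes rm: "riemannian_metric (g :: 'a tensor)"
    and "norm v = 1" "has_dir \<xi> w" "arccos (v \<bullet> w) < \<epsilon>" "0 \<le> s" "R < s"
  shows "Inl (s *\<^sub>R w) \<in> truncated_cone g 0 v \<epsilon> R"
proof -
  obtain c c' where c: "unit_ray g c c'" "c 0 = 0" "c' 0 = w"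
    using assms(3) unfolding has_dir_def by blast
  have cs: "c s = s *\<^sub>R w" using unit_ray_from_origin(2)[OF c(1,2)] c assms by simp
  have nw: "norm w = 1" using has_dir_norm assms by blast
  have "s = dist 0 (c s)" using cs nw assms by simp
  also have "\<dots> \<le> riem_dist g 0 (c s)" by (rule riem_dist_ge[OF rm])
  finally have "R < riem_dist g 0 (c s)" using assms by simp
  moreover have "tangent_angle g 0 v (c' 0) < \<epsilon>"
    using tangent_angle_origin[of v w] assms nw c by simp
  ultimately show ?thesis
    using c assms(5) cs unfolding Inl_in_truncated_cone_iff
    by (intro exI[of _ c] exI[of _ c'] exI[of _ s]) simp
qed

text \<open>Induction on the generation of \<open>U\<close>. A generating set containing a point at
  infinity must be a truncated cone, and the angle with its axis depends continuously on the
  direction.\<close>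

lemma boundary_nbhd:
  fixes e :: "'a::euclidean_space"
  assumes rm: "riemannian_metric (g :: 'a tensor)"
    and "openin (cone_topology g 0) U" "\<xi> \<in> U" and e: "has_dir \<xi> e"
  shows "\<exists>\<delta>>0. \<forall>\<eta> w. has_dir \<eta> w \<and> dist w e < \<delta> \<longrightarrow> \<eta> \<in> U"
  using assms(2,3) unfolding cone_topology_def openin_topology_generated_by_iff
proof induction
  case (Int A B)
  then obtain d1 d2 where "d1 > 0" "\<forall>\<eta> w. has_dir \<eta> w \<and> dist w e < d1 \<longrightarrow> \<eta> \<in> A"
    "d2 > 0" "\<forall>\<eta> w. has_dir \<eta> w \<and> dist w e < d2 \<longrightarrow> \<eta> \<in> B" by auto
  then show ?case by (intro exI[of _ "min d1 d2"]) auto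
next
  case (UN K)
  then obtain A where "A \<in> K" "\<xi> \<in> A" by blast
  with UN.IH[OF this] show ?case by blast
next
  case (Basis A)
  have \<xi>: "\<xi> \<in> asymptotic_boundary g" "\<And>y. \<xi> \<noteq> Inl y" using e by (auto simp: has_dir_def)
  then have "A \<noteq> Inl ` V" for V using Basis.prems by blast
  with Basis.hyps obtain v \<epsilon> R where A: "A = truncated_cone g 0 v \<epsilon> R" and v: "norm v = 1"
    by (auto simp: metric_0 norm_eq_1)
  then obtain w where "has_dir \<xi> w" "arccos (v \<bullet> w) < \<epsilon>"
    using Basis boundary_in_truncated_cone_iff[OF v \<xi>(1)] by blast
  then have lt: "arccos (v \<bullet> e) < \<epsilon>" using has_dir_unique[OF rm e] by metis
  have "\<bar>v \<bullet> w\<bar> \<le> 1" if "norm w = 1" for w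
    using Cauchy_Schwarz_ineq2[of v w] that v by simp
  then have "continuous_on (sphere 0 1) (\<lambda>w. arccos (v \<bullet> w))"
    by (intro continuous_intros) (auto simp: abs_le_iff)
  moreover have "e \<in> sphere 0 1" using has_dir_norm[OF e] by simp
  ultimately obtain d where d: "d > 0"
    "\<And>w. norm w = 1 \<Longrightarrow> dist w e < d \<Longrightarrow> dist (arccos (v \<bullet> w)) (arccos (v \<bullet> e)) < \<epsilon> - arccos (v \<bullet> e)"
    unfolding continuous_on_iff using lt by (metis diff_gt_0_iff_gt mem_sphere_0)
  have "\<eta> \<in> A" if "has_dir \<eta> w" "dist w e < d" for \<eta> w
  proof -
    have "arccos (v \<bullet> w) < \<epsilon>"
      using d(2)[OF has_dir_norm[OF that(1)] that(2)] by (simp add: dist_real_def)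
    moreover have "\<eta> \<in> asymptotic_boundary g" using that by (simp add: has_dir_def)
    ultimately show ?thesis unfolding A using boundary_in_truncated_cone_iff[OF v] that by blast
  qed
  with d(1) show ?case by blast
qed simp

text \<open>The same induction: a straight ray whose direction lies in the cone belongs to it beyond
  Euclidean, hence Riemannian, distance \<open>R\<close>.\<close>

lemma ray_eventually_in_nbhd:
  fixes w :: "'a::euclidean_space"
  assumes rm: "riemannian_metric (g :: 'a tensor)"
    and "openin (cone_topology g 0) U" "\<xi> \<in> U" and w: "has_dir \<xi> w"
  shows "\<exists>s0. \<forall>s>s0. Inl (s *\<^sub>R w) \<in> U"
  using assms(2,3) unfolding cone_topology_def openin_topology_generated_by_iff
proof induction
  case (Int A B)
  then obtain s1 s2 where "\<forall>s>s1. Inl (s *\<^sub>R w) \<in> A" "\<forall>s>s2. Inl (s *\<^sub>R w) \<in> B" by auto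
  then show ?case by (intro exI[of _ "max s1 s2"]) auto
next
  case (UN K)
  then obtain A where "A \<in> K" "\<xi> \<in> A" by blast
  with UN.IH[OF this] show ?case by blast
next
  case (Basis A)
  have \<xi>: "\<xi> \<in> asymptotic_boundary g" "\<And>y. \<xi> \<noteq> Inl y" using w by (auto simp: has_dir_def)
  then have "A \<noteq> Inl ` V" for V using Basis.prems by blast
  with Basis.hyps obtain v \<epsilon> R where A: "A = truncated_cone g 0 v \<epsilon> R" and v: "norm v = 1"
    by (auto simp: metric_0 norm_eq_1)
  then obtain w' where "has_dir \<xi> w'" "arccos (v \<bullet> w') < \<epsilon>"
    using Basis boundary_in_truncated_cone_iff[OF v \<xi>(1)] by blast
  then have "arccos (v \<bullet> w) < \<epsilon>" using has_dir_unique[OF rm w] by metis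
  then show ?case
    unfolding A using point_in_truncated_coneI[OF rm v w] by (intro exI[of _ "max 0 R"]) auto
qed simp

text \<open>
  The truncated cones with vertex 0 contain only classes having a ray from 0, so no existence
  theorem for rays in a given class is needed.
\<close>

lemma has_dir_exists:
  fixes \<xi> :: "'a::euclidean_space compactified"
  assumes "\<xi> \<in> topspace (cone_topology g 0)" "\<xi> \<in> asymptotic_boundary g"
  shows "\<exists>w. has_dir \<xi> w"
proof -
  have "\<xi> \<noteq> Inl y" for y using assms(2) by (auto simp: asymptotic_boundary_def)
  then obtain v \<epsilon> R where "\<xi> \<in> truncated_cone g 0 v \<epsilon> R" "norm v = 1"
    using assms(1) by (auto simp: cone_topology_def metric_0 norm_eq_1)
  then show ?thesis using boundary_in_truncated_cone_iff assms(2) by blast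
qed

section \<open>Directions at infinity of the hyperboloid region\<close>

lemma openin_truncated_cone:
  "norm v = 1 \<Longrightarrow> \<epsilon> > 0 \<Longrightarrow> R > 0 \<Longrightarrow> openin (cone_topology g 0) (truncated_cone g 0 v \<epsilon> R)"
  unfolding cone_topology_def
  by (rule topology_generated_by_Basis) (auto simp: metric_0 norm_eq_1)

text \<open>Otherwise a narrow cone around \<open>w\<close> contains only directions
  \<open>w'\<close> with \<open>w' \<bullet> e < a\<close>, hence no point of the region, and
  \<open>\<eta>\<close> is not in its closure.\<close>

lemma boundary_dir_ge:
  fixes e w :: "'a::euclidean_space"
  assumes "norm e = 1" "0 \<le> a" "has_dir \<eta> w"
    and \<eta>: "\<eta> \<in> boundary_at_infinity g 0 {x. a * norm x + 1 / k < x \<bullet> e}"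
  shows "a \<le> w \<bullet> e"
proof (rule ccontr)
  assume "\<not> a \<le> w \<bullet> e"
  \<comment> \<open>For unit vectors the squared chord is \<open>2 - 2 * (w \<bullet> w')\<close>,
    so the angle \<open>arccos (1 - \<gamma>\<^sup>2 / 2)\<close> corresponds to chord length
    \<open>\<gamma>\<close>; the cap at 1 keeps the argument of \<open>arccos\<close> in its
    domain.\<close>
  define \<gamma> where "\<gamma> = min 1 (a - w \<bullet> e)"
  have \<gamma>: "0 < \<gamma>" "\<gamma> \<le> 1" "\<gamma> \<le> a - w \<bullet> e" using \<open>\<not> a \<le> w \<bullet> e\<close> by (auto simp: \<gamma>_def)
  have \<gamma>2: "0 < \<gamma>\<^sup>2" "\<gamma>\<^sup>2 \<le> 1" using \<gamma> by (auto simp: power_le_one)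
  have nw: "norm w = 1" using has_dir_norm assms by blast
  have ww: "w \<bullet> w = 1" using nw by (simp add: norm_eq_1)
  define \<epsilon> where "\<epsilon> = arccos (1 - \<gamma>\<^sup>2 / 2)"
  have "arccos 1 < \<epsilon>" unfolding \<epsilon>_def using \<gamma>2 by (intro arccos_less_arccos) auto
  then have \<epsilon>: "0 < \<epsilon>" by simp
  have "\<eta> \<in> asymptotic_boundary g" using \<eta> by (simp add: boundary_at_infinity_def)
  then have "\<eta> \<in> truncated_cone g 0 w \<epsilon> 1"
    using boundary_in_truncated_cone_iff[OF nw] assms(3) \<epsilon> ww by (metis arccos_1)
  then obtain x where x: "a * norm x + 1 / k < x \<bullet> e" "Inl x \<in> truncated_cone g 0 w \<epsilon> 1"
    using \<eta> openin_truncated_cone[OF nw \<epsilon>, of 1]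
    by (force simp: boundary_at_infinity_def in_closure_of)
  obtain s w' where w': "x = s *\<^sub>R w'" "0 \<le> s" "norm w' = 1" "arccos (w \<bullet> w') < \<epsilon>"
    using point_in_truncated_cone[OF nw x(2)] .
  have "1 - \<gamma>\<^sup>2 / 2 < w \<bullet> w'"
    using w'(4) \<gamma>2 Cauchy_Schwarz_ineq2[of w w'] nw w'(3) unfolding \<epsilon>_def
    by (subst (asm) arccos_less_mono) auto
  then have "(norm (w' - w))\<^sup>2 < \<gamma>\<^sup>2"
    using w'(3) ww by (simp add: power2_norm_eq_inner norm_eq_1 inner_diff_left inner_diff_right inner_commute)
  then have "norm (w' - w) < \<gamma>" using \<gamma>(1) by (simp add: power_less_imp_less_base)
  moreover have "(w' - w) \<bullet> e \<le> norm (w' - w)"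
    using norm_cauchy_schwarz[of "w' - w" e] assms(1) by simp
  ultimately have "w' \<bullet> e < a" using \<gamma>(3) by (simp add: inner_diff_left)
  then have "s * (w' \<bullet> e) \<le> a * s" using mult_left_mono[of "w' \<bullet> e" a s] w'(2) by (simp add: mult.commute)
  moreover have "1 / k > 0" using k_pos by simp
  moreover have "a * s + 1 / k < s * (w' \<bullet> e)" using x(1) w' by simp
  ultimately show False by linarith
qed

text \<open>The ray in direction \<open>w\<close> is inside the region as soon as
  \<open>s * (w \<bullet> e - a) > 1 / k\<close>, and it eventually enters every neighborhood of
  \<open>\<eta>\<close>.\<close>

lemma boundary_if_dir_gt:
  fixes e w :: "'a::euclidean_space"
  assumes rm: "riemannian_metric (g :: 'a tensor)"
    and w: "has_dir \<eta> w" "a < w \<bullet> e" and top: "\<eta> \<in> topspace (cone_topology g 0)"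
  shows "\<eta> \<in> boundary_at_infinity g 0 {x. a * norm x + 1 / k < x \<bullet> e}"
proof -
  have "\<exists>y. y \<in> Inl ` {x. a * norm x + 1 / k < x \<bullet> e} \<and> y \<in> U"
    if U: "\<eta> \<in> U \<and> openin (cone_topology g 0) U" for U
  proof -
  obtain s0 where s0: "\<And>s. s > s0 \<Longrightarrow> Inl (s *\<^sub>R w) \<in> U"
    using ray_eventually_in_nbhd[OF rm _ _ w(1)] U by blast
  define s where "s = max 0 s0 + 1 / k / (w \<bullet> e - a) + 1"
  have p: "1 / k / (w \<bullet> e - a) > 0" using w k_pos by simp
  then have s: "s > s0" "s > 0" "1 / k / (w \<bullet> e - a) < s" unfolding s_def by linarith+
  have "norm (s *\<^sub>R w) = s" using has_dir_norm[OF w(1)] s by simp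
  moreover have "1 / k < s * (w \<bullet> e - a)" by (rule pos_divide_less_eq[THEN iffD1, OF _ s(3)]) (use w in simp)
  ultimately have "a * norm (s *\<^sub>R w) + 1 / k < s *\<^sub>R w \<bullet> e" by (simp add: algebra_simps)
  with s0[OF s(1)] show ?thesis by blast
  qed
  moreover have "\<eta> \<in> asymptotic_boundary g" using w by (simp add: has_dir_def)
  ultimately show ?thesis
    using top by (auto simp: boundary_at_infinity_def in_closure_of)
qed

end

section \<open>The strict convexity condition\<close>

lemma Ck_on_cong:
  assumes "open S" "\<And>x. x \<in> S \<Longrightarrow> h x = h' x"
  shows "Ck_on n S h \<longleftrightarrow> Ck_on n S h'"
  using assms(2)
proof (induction n arbitrary: h h')
  case 0
  then show ?case by (simp cong: continuous_on_cong)
next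
  case (Suc n)
  have D: "(h has_derivative D) (at x) \<longleftrightarrow> (h' has_derivative D) (at x)" if "x \<in> S" for x D
    using has_derivative_transform_within_open[OF _ assms(1) that, of h D UNIV h']
      has_derivative_transform_within_open[OF _ assms(1) that, of h' D UNIV h] Suc.prems by auto
  then have "h differentiable (at x) \<longleftrightarrow> h' differentiable (at x)" if "x \<in> S" for x
    using that by (simp add: differentiable_def)
  moreover have "frechet_derivative h (at x) = frechet_derivative h' (at x)" if "x \<in> S" for x
    using D[OF that] by (simp add: frechet_derivative_def)
  ultimately show ?case
    using Suc.IH[of "\<lambda>x. frechet_derivative h (at x) v" "\<lambda>x. frechet_derivative h' (at x) v" for v] by simp
qed

lemma Ck_on_SucI:
  assumes "open S" "\<And>x. x \<in> S \<Longrightarrow> (h has_derivative D x) (at x)" "\<And>v. Ck_on n S (\<lambda>x. D x v)"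
  shows "Ck_on (Suc n) S h"
proof -
  have "frechet_derivative h (at x) = D x" if "x \<in> S" for x
    using frechet_derivative_at[OF assms(2)[OF that]] by simp
  then have "Ck_on n S (\<lambda>x. frechet_derivative h (at x) v)" for v
    using Ck_on_cong[OF assms(1), of "\<lambda>x. frechet_derivative h (at x) v" "\<lambda>x. D x v"] assms(3) by simp
  then show ?thesis using assms(2) by (auto simp: differentiable_def)
qed

text \<open>Since \<open>b > 0\<close>, the boundary avoids the origin, and one defining function on
  the punctured space suffices. Its derivative in direction \<open>e\<close> is at most
  \<open>a - 1 < 0\<close>.\<close>

lemma C2_domain_hyperboloid:
  fixes e :: "'a::euclidean_space"
  assumes e: "norm e = 1" and a: "a < 1" "0 \<le> a" and b: "b > 0"
  shows "C2_domain {x. a * norm x + b < x \<bullet> e}"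
  unfolding C2_domain_def
proof (intro conjI ballI)
  show "open {x. a * norm x + b < x \<bullet> e}"
    by (intro open_Collect_less continuous_intros)
  fix x assume x: "x \<in> frontier {x. a * norm x + b < x \<bullet> e}"
  have "closure {x. a * norm x + b < x \<bullet> e} \<subseteq> {x. a * norm x + b \<le> x \<bullet> e}"
    by (intro closure_minimal closed_Collect_le continuous_intros) auto
  with x b have "x \<noteq> 0" by (auto simp: frontier_def)
  define \<rho> where "\<rho> y = a * norm y + b - y \<bullet> e" for y
  have D: "(\<rho> has_derivative (\<lambda>v. a * ((v \<bullet> y) / norm y) - v \<bullet> e)) (at y)" if "y \<noteq> 0" for y
    unfolding \<rho>_def using that
    by (auto intro!: derivative_eq_intros norm_has_derivative)
  have "Ck_on 2 (- {0}) \<rho>"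
    unfolding numeral_2_eq_2
  proof (rule Ck_on_SucI[OF _ D])
    fix v :: 'a
    show "Ck_on (Suc 0) (- {0}) (\<lambda>y. a * ((v \<bullet> y) / norm y) - v \<bullet> e)"
    proof (rule Ck_on_SucI)
      show "((\<lambda>y. a * ((v \<bullet> y) / norm y) - v \<bullet> e) has_derivative
          (\<lambda>u. a * ((v \<bullet> u) / norm y - (v \<bullet> y) * (u \<bullet> y) / norm y ^ 3))) (at y)" if "y \<in> - {0}" for y
        using that
        by (auto intro!: derivative_eq_intros norm_has_derivative)
          (auto simp: fun_eq_iff field_simps eval_nat_numeral)
    qed (auto intro!: continuous_intros)
  qed auto
  moreover have "\<exists>v. frechet_derivative \<rho> (at y) v \<noteq> 0" if "y \<in> - {0}" for y
  proof -
    have "a * ((e \<bullet> y) / norm y) \<le> a * 1"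
      using norm_cauchy_schwarz[of e y] e that a by (intro mult_left_mono) auto
    moreover have "e \<bullet> e = 1" using e by (simp add: norm_eq_1)
    ultimately have "a * ((e \<bullet> y) / norm y) - e \<bullet> e \<noteq> 0" using a by linarith
    moreover have "frechet_derivative \<rho> (at y) = (\<lambda>v. a * ((v \<bullet> y) / norm y) - v \<bullet> e)"
      using frechet_derivative_at[OF D[of y]] that by simp
    ultimately show ?thesis by metis
  qed
  moreover have "{x. a * norm x + b < x \<bullet> e} \<inter> - {0} = {y \<in> - {0}. \<rho> y < 0}"
    by (auto simp: \<rho>_def)
  ultimately show "\<exists>U \<rho>. open U \<and> x \<in> U \<and> Ck_on 2 U \<rho> \<and>
        (\<forall>y\<in>U. \<exists>v. frechet_derivative \<rho> (at y) v \<noteq> 0) \<and>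
        {x. a * norm x + b < x \<bullet> e} \<inter> U = {y \<in> U. \<rho> y < 0}"
    using \<open>x \<noteq> 0\<close> by (intro exI[of _ "- {0}"] exI[of _ \<rho>] conjI ballI) (auto simp del: Ck_on.simps)
qed

text \<open>The boundary at infinity of \<open>\<Omega>\<close> lies between the caps
  \<open>w \<bullet> e > a\<close> and \<open>w \<bullet> e \<ge> a\<close>. The first, cut out by a
  truncated cone, is open and contains \<open>x\<close>; the second is small enough to lie in
  \<open>W\<close>.\<close>

lemma (in curved_warping) SC_condition_warped:
  assumes rm: "riemannian_metric (g :: 'a::euclidean_space tensor)"
  shows "SC_condition (g :: 'a tensor) 0"
  unfolding SC_condition_def Let_def
proof (intro ballI allI impI, elim conjE)
  fix x :: "'a compactified" and W
  assume x: "x \<in> asymptotic_boundary g" "x \<in> W"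
    and "openin (subtopology (cone_topology g 0) (asymptotic_boundary g)) W"
  then obtain U where U: "openin (cone_topology g 0) U" "W = U \<inter> asymptotic_boundary g"
    by (auto simp: openin_subtopology)
  have top: "x \<in> topspace (cone_topology g 0)"
    using U x openin_subset by blast
  obtain e where e: "has_dir x e" using has_dir_exists[OF top x(1)] by blast
  have ne: "norm e = 1" using has_dir_norm[OF e] .
  obtain \<delta> where \<delta>: "\<delta> > 0" "\<And>\<eta> w. has_dir \<eta> w \<Longrightarrow> dist w e < \<delta> \<Longrightarrow> \<eta> \<in> U"
    using boundary_nbhd[OF rm U(1) _ e] x U by blast
  \<comment> \<open>Chosen so that \<open>w \<bullet> e \<ge> a\<close> gives a squared chord of at
    most \<open>2 - 2 * a \<le> \<delta>\<^sup>2 / 2\<close>; the maximum with 0 secures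
    \<open>0 \<le> a\<close> when \<open>\<delta>\<close> is large.\<close>
  define a where "a = max 0 (1 - \<delta>\<^sup>2 / 4)"
  have a: "0 \<le> a" "a < 1" "1 - \<delta>\<^sup>2 / 4 \<le> a" using \<delta> by (auto simp: a_def)
  define \<Omega> where "\<Omega> = {x. a * norm x + 1 / k < x \<bullet> e}"
  let ?T = "subtopology (cone_topology g 0) (asymptotic_boundary g)"
  have "boundary_at_infinity g 0 \<Omega> \<subseteq> W"
  proof
    fix \<eta> assume \<eta>: "\<eta> \<in> boundary_at_infinity g 0 \<Omega>"
    then have "\<eta> \<in> asymptotic_boundary g" "\<eta> \<in> topspace (cone_topology g 0)"
      by (auto simp: boundary_at_infinity_def in_closure_of)
    then obtain w where w: "has_dir \<eta> w" using has_dir_exists by blast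
    have "a \<le> w \<bullet> e"
      by (rule boundary_dir_ge[OF ne a(1) w]) (use \<eta> in \<open>simp add: \<Omega>_def\<close>)
    then have "(dist w e)\<^sup>2 \<le> \<delta>\<^sup>2 / 2"
      using ne has_dir_norm[OF w] a(3)
      by (simp add: dist_norm power2_norm_eq_inner norm_eq_1 inner_diff_left inner_diff_right inner_commute)
    also have "\<dots> < \<delta>\<^sup>2" using \<delta> by simp
    finally have "dist w e < \<delta>" using \<delta>(1) by (simp add: power_less_imp_less_base)
    with w \<delta>(2) \<open>\<eta> \<in> asymptotic_boundary g\<close> show "\<eta> \<in> W" by (auto simp: U)
  qed
  then have "?T interior_of boundary_at_infinity g 0 \<Omega> \<subseteq> W"
    by (rule order_trans[OF interior_of_subset])
  moreover have "x \<in> ?T interior_of boundary_at_infinity g 0 \<Omega>"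
  proof -
    have "arccos 1 < arccos a" using a by (intro arccos_less_arccos) auto
    then have pos: "0 < arccos a" by simp
    define N where "N = asymptotic_boundary g \<inter> truncated_cone g 0 e (arccos a) 1"
    have op: "openin (cone_topology g 0) (truncated_cone g 0 e (arccos a) 1)"
      using openin_truncated_cone[OF ne pos, of 1] by simp
    have "openin ?T N"
      unfolding N_def using op by (rule openin_subtopology_Int2)
    moreover have "N \<subseteq> boundary_at_infinity g 0 \<Omega>"
    proof
      fix \<eta> assume \<eta>: "\<eta> \<in> N"
      then obtain w where w: "has_dir \<eta> w" "arccos (e \<bullet> w) < arccos a"
        using boundary_in_truncated_cone_iff[OF ne] by (auto simp: N_def)
      have "a < w \<bullet> e"
        using w(2) a Cauchy_Schwarz_ineq2[of e w] ne has_dir_norm[OF w(1)]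
        by (subst (asm) arccos_less_mono) (auto simp: inner_commute)
      then show "\<eta> \<in> boundary_at_infinity g 0 \<Omega>"
        unfolding \<Omega>_def using \<eta> op openin_subset by (intro boundary_if_dir_gt[OF rm w(1)]) (auto simp: N_def)
    qed
    moreover have "x \<in> N"
      using boundary_in_truncated_cone_iff[OF ne x(1)] e x(1) pos ne
      by (auto simp: N_def norm_eq_1 intro!: exI[of _ e])
    ultimately show ?thesis using interior_of_maximal by blast
  qed
  moreover have "C2_domain \<Omega>"
    unfolding \<Omega>_def using C2_domain_hyperboloid[OF ne a(2,1)] k_pos by simp
  moreover have "geodesically_convex g (- \<Omega>)"
    unfolding \<Omega>_def by (rule convex_complement[OF ne])
  ultimately show "\<exists>\<Omega>. C2_domain \<Omega> \<and> x \<in> ?T interior_of boundary_at_infinity g 0 \<Omega> \<and>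
      ?T interior_of boundary_at_infinity g 0 \<Omega> \<subseteq> W \<and> geodesically_convex g (- \<Omega>)"
    by blast
qed

text \<open>
  In dimension 1 there are no planes and hence no information about \<open>f\<close>, but the metric does not
  depend on \<open>f\<close> either, and the hyperbolic warping function can be used.
\<close>

lemma warped_metric_DIM_1:
  assumes "DIM('a::euclidean_space) = 1"
  shows "(warped_metric f :: 'a tensor) = warped_metric f'"
proof -
  obtain b :: 'a where b: "Basis = {b}" using assms by (rule card_1_singletonE)
  have inner: "u \<bullet> v = (u \<bullet> b) * (v \<bullet> b)" for u v :: 'a
    by (subst euclidean_inner) (simp add: b)
  have radial: "u \<bullet> v - (u \<bullet> sgn x) * (v \<bullet> sgn x) = 0" if "x \<noteq> 0" for x u v :: 'a
  proof -
    have "sgn x \<bullet> sgn x = 1" using that by (simp add: norm_sgn flip: norm_eq_1)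
    then have 1: "(sgn x \<bullet> b) * (sgn x \<bullet> b) = 1" by (simp only: inner[of "sgn x" "sgn x"])
    have "(u \<bullet> sgn x) * (v \<bullet> sgn x) = (u \<bullet> b) * (v \<bullet> b) * ((sgn x \<bullet> b) * (sgn x \<bullet> b))"
      by (simp only: inner[of u "sgn x"] inner[of v "sgn x"] mult_ac)
    also have "\<dots> = u \<bullet> v" by (simp only: 1 mult_1_right inner[of u v])
    finally show ?thesis by simp
  qed
  show ?thesis unfolding warped_metric_def by (intro ext if_cong refl) (simp add: radial)
qed

lemma curved_warping_sinh: "k > 0 \<Longrightarrow>
  curved_warping (\<lambda>t. sinh (k * t) / k) (\<lambda>t. cosh (k * t)) (\<lambda>t. k * sinh (k * t)) k"
  by unfold_locales (auto intro!: derivative_eq_intros simp: power2_eq_square)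

text \<open>The witness sequence in \<open>smooth_on_halfline\<close> supplies the derivatives, and
  uniqueness of the one-sided derivative at 0 gives \<open>D 1 0 = 1\<close>.\<close>

lemma exists_warping:
  assumes "smooth_on_halfline f" "f 0 = 0" "(f has_real_derivative 1) (at 0 within {0..})" "\<forall>t>0. f t > 0"
  shows "\<exists>f1 f2. warping f f1 f2"
proof -
  obtain D where D: "\<And>t. t \<ge> 0 \<Longrightarrow> D 0 t = f t"
    "\<And>n t. t \<ge> 0 \<Longrightarrow> (D n has_real_derivative D (Suc n) t) (at t within {0..})"
    using assms(1) unfolding smooth_on_halfline_def by blast
  have f: "(f has_real_derivative D 1 t) (at t within {0..})" if "0 \<le> t" for t
    unfolding has_field_derivative_def
    by (rule has_derivative_transform[of _ _ _ "D 0"])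
      (use that D(1) D(2)[OF that, of 0] in \<open>auto simp: has_field_derivative_def\<close>)
  have "D 1 0 = 1"
    using f[of 0] assms(3) unfolding has_real_derivative_iff_has_vector_derivative
    by (intro vector_derivative_unique_within_closed_interval[of 0 1 0 f])
      (auto intro: has_vector_derivative_within_subset)
  then have "warping f (D 1) (D 2)"
    using assms f D(2)[of _ 1] by unfold_locales (auto simp: numeral_2_eq_2)
  then show ?thesis by blast
qed

theorem theorem13:
  fixes g :: "'a::euclidean_space tensor" and k :: real
  assumes "k > 0"
    and "hadamard g"
    and "rotationally_symmetric g"
    and "sectional_curvature_le g (- (k\<^sup>2))"
  shows "SC_condition g 0"
proof -
  obtain f where f: "smooth_on_halfline f" "f 0 = 0" "(f has_real_derivative 1) (at 0 within {0..})"
    "\<forall>t>0. f t > 0" and g: "g = warped_metric f"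
    using assms(3) unfolding rotationally_symmetric_def by blast
  have rm: "riemannian_metric g" using assms(2) by (simp add: hadamard_def)
  show ?thesis
  proof (cases "DIM('a) = 1")
    case True
    interpret curved_warping "\<lambda>t. sinh (k * t) / k" "\<lambda>t. cosh (k * t)" "\<lambda>t. k * sinh (k * t)" k
      by (rule curved_warping_sinh) fact
    have "g = warped_metric (\<lambda>t. sinh (k * t) / k)"
      unfolding g by (rule warped_metric_DIM_1[OF True])
    with SC_condition_warped[where 'a='a] rm show ?thesis by simp
  next
    case False
    obtain f1 f2 where "warping f f1 f2" using exists_warping[OF f] by blast
    then interpret warping f f1 f2 .
    \<comment> \<open>Two distinct basis vectors span a plane at \<open>t *\<^sub>R e\<close> that
      contains the radial direction; its curvature turns the bound into the differential inequality
      for \<open>f\<close>.\<close>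
    obtain e :: 'a where e: "e \<in> Basis" using nonempty_Basis by blast
    have "Basis \<noteq> {e}"
    proof
      assume "Basis = {e}"
      then have "DIM('a) = card {e}" by (rule arg_cong)
      with False show False by simp
    qed
    then obtain v :: 'a where v: "v \<in> Basis" "v \<noteq> e" using e by blast
    have ind: "independent {e, v}"
      by (rule independent_mono[OF independent_Basis]) (use e v in auto)
    have "k\<^sup>2 * f t \<le> f2 t" if t: "0 < t" for t
    proof -
      have "sectional_curvature g (t *\<^sub>R e) e v = - f2 t / f t"
        unfolding g using radial_curvature[OF t, of e v] e v by (simp add: inner_Basis)
      moreover have "sectional_curvature g (t *\<^sub>R e) e v \<le> - (k\<^sup>2)"
        using assms(4)[unfolded sectional_curvature_le_def, rule_format, of e v "t *\<^sub>R e"] ind v(2) by simp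
      ultimately have "k\<^sup>2 \<le> f2 t / f t" by simp
      then show ?thesis using f_pos[OF t] by (simp add: pos_le_divide_eq)
    qed
    then interpret curved_warping f f1 f2 k
      using assms(1) by unfold_locales
    show ?thesis
      using SC_condition_warped[where 'a='a] rm g by simp
  qed
qed

end
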